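(* Consider the following pricing model for a reusable resource with $C=2$ identical units. Customers arrive as a Poisson process; at price $p$ the effective arrival rate is $\lambda(p)$, where demand is linear: $p(\lambda)=(b-\lambda)/a$ for $\lambda\in[0,b]$, with $a,b>0$. A customer arriving when a unit is available and the effective rate is $\lambda$ buys, pays $p(\lambda)$, and occupies one unit for an exponential time with mean $1/\mu$ ($\mu>0$ arbitrary), i.i.d. and independent of everything else; the firm incurs cost $c>0$ per customer served; customers arriving when both units are occupied are lost. A policy chooses non-anticipatingly an effective arrival rate $\lambda(t)\in[0,b]$; a static policy uses a constant rate. With $Q^\pi(t)$ the number of available units and $N^\pi(t)$ the arrival process with intensity $\lambda(t)$, the long-run profit rate is $R^\pi=\liminf_{T\to\infty}\frac1T\mathbb{E}\big[\int_0^T\mathbf 1\{Q^\pi(t)>0\}(p(\lambda(t))-c)\,dN^\pi(t)\big]$. Let $\pi^*$ be a profit-maximizing dynamic (non-anticipating) policy. Then there exists a static pricing policy $\pi^s$ such that $$\frac{R^{\pi^s}}{R^{\pi^*}}\ge 0.955.$$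
   Context: All definitions are in the statement. *)

theory Defs
  imports "HOL-Probability.Probability"
begin

datatype source = Gap nat | Valuation nat | Service nat | Exogenous

text \<open>
  Potential customers form a Poisson process of rate \<open>b\<close>, the demand at price \<open>0\<close>, given by
  i.i.d. exponential gaps.  Customer \<open>n\<close> has a valuation uniform on \<open>[0, b/a]\<close> and buys at price
  \<open>p\<close> iff the valuation is at least \<open>p\<close>.  At price \<open>p \<in> [0, b/a]\<close> the effective arrival rate is
  therefore \<open>b * (1 - p / (b/a)) = b - a * p\<close>, that is, \<open>p = (b - l) / a\<close> at effective rate \<open>l\<close>;
  so the effective arrivals below have intensity \<open>l(t)\<close>.  The variable \<open>exo\<close> is independent
  of the system and lets policies randomize; its distribution is arbitrary.
\<close>

locale reusable_resource = prob_space M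
  for M :: "'w measure"
    and C :: nat and a b \<mu> c :: real
    and gap val service :: "nat \<Rightarrow> 'w \<Rightarrow> real"
    and exo :: "'w \<Rightarrow> real" +
  assumes units_pos: "0 < C"
    and slope_pos: "0 < a"
    and max_rate_pos: "0 < b"
    and service_rate_pos: "0 < \<mu>"
    and cost_pos: "0 < c"
    and gap_distr: "\<And>n. distributed M lborel (gap n) (exponential_density b)"
    and val_distr: "\<And>n. distr M borel (val n) = uniform_measure lborel {0..b / a}"
    and service_distr: "\<And>n. distributed M lborel (service n) (exponential_density \<mu>)"
    and independent_sources:
      "indep_vars (\<lambda>_. borel)
         (\<lambda>s. case s of Gap n \<Rightarrow> gap n | Valuation n \<Rightarrow> val n | Service n \<Rightarrow> service n
                     | Exogenous \<Rightarrow> exo) UNIV"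
begin

definition price :: "real \<Rightarrow> real" where
  "price l = (b - l) / a"

definition arrival :: "nat \<Rightarrow> 'w \<Rightarrow> real" where
  "arrival n \<omega> = (\<Sum>i\<le>n. gap i \<omega>)"

text \<open>
  \<open>history t\<close> is the information available at time \<open>t\<close>: the exogenous variable, the arrival times
  and valuations of all potential customers up to \<open>t\<close>, and all service completions up to \<open>t\<close>.
  It reveals nothing about the residual service time of a customer still in service.
  The service time of a customer who is not admitted plays no role in the system,
  so recording it here is harmless and keeps \<open>history\<close> the same for all policies.
\<close>

definition history :: "real \<Rightarrow> 'w measure" where
  "history t = sigma (space M)
     ({exo -` B \<inter> space M | B. B \<in> sets borel}
      \<union> {{\<omega> \<in> space M. arrival n \<omega> \<le> s \<and> val n \<omega> \<le> v} | n s v. s \<le> t}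
      \<union> {{\<omega> \<in> space M. arrival n \<omega> + service n \<omega> \<le> s} | n s. s \<le> t})"

text \<open>
  The predictable sigma-algebra of \<open>history\<close>.  The time axis is extended to negative times, where
  only the information of time \<open>0\<close> is available; this has no effect on the system.
\<close>

definition predictable :: "(real \<times> 'w) measure" where
  "predictable = sigma (UNIV \<times> space M)
     ({{..0} \<times> A | A. A \<in> sets (history 0)}
      \<union> {{s<..t} \<times> A | s t A. 0 \<le> s \<and> s < t \<and> A \<in> sets (history s)})"

definition policy :: "(real \<Rightarrow> 'w \<Rightarrow> real) \<Rightarrow> bool" where
  "policy \<sigma> \<longleftrightarrow> (\<forall>t. \<forall>\<omega>\<in>space M. \<sigma> t \<omega> \<in> {0..b}) \<and>
     (\<lambda>(t, \<omega>). \<sigma> t \<omega>) \<in> borel_measurable predictable"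

definition static_policy :: "(real \<Rightarrow> 'w \<Rightarrow> real) \<Rightarrow> bool" where
  "static_policy \<sigma> \<longleftrightarrow> policy \<sigma> \<and> (\<exists>l. \<forall>t \<omega>. \<sigma> t \<omega> = l)"

text \<open>
  The effective arrivals are the potential customers who buy if a unit is available; their arrival
  times are the jump times of the effective arrival process.
\<close>

definition effective :: "(real \<Rightarrow> 'w \<Rightarrow> real) \<Rightarrow> nat \<Rightarrow> 'w \<Rightarrow> bool" where
  "effective \<sigma> n \<omega> \<longleftrightarrow> price (\<sigma> (arrival n \<omega>) \<omega>) \<le> val n \<omega>"

text \<open>
  Number of customers from \<open>D\<close> occupying a unit immediately before time \<open>t\<close>.
  The left limit is needed so that an arriving customer does not count as occupying a unit
  at the own arrival time.
\<close>

definition occupied_before :: "nat set \<Rightarrow> real \<Rightarrow> 'w \<Rightarrow> nat" where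
  "occupied_before D t \<omega> =
     card {m \<in> D. arrival m \<omega> < t \<and> t \<le> arrival m \<omega> + service m \<omega>}"

primrec served_upto :: "(real \<Rightarrow> 'w \<Rightarrow> real) \<Rightarrow> nat \<Rightarrow> 'w \<Rightarrow> nat set" where
  "served_upto \<sigma> 0 \<omega> = {}"
| "served_upto \<sigma> (Suc n) \<omega> =
     (if effective \<sigma> n \<omega> \<and> occupied_before (served_upto \<sigma> n \<omega>) (arrival n \<omega>) \<omega> < C
      then insert n (served_upto \<sigma> n \<omega>) else served_upto \<sigma> n \<omega>)"

definition available_before :: "(real \<Rightarrow> 'w \<Rightarrow> real) \<Rightarrow> real \<Rightarrow> 'w \<Rightarrow> nat" where
  "available_before \<sigma> t \<omega> = C - occupied_before (\<Union>n. served_upto \<sigma> n \<omega>) t \<omega>"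

text \<open>
  The integral of \<open>1{Q > 0} * (p(l) - c)\<close> over \<open>[0, T]\<close> against the effective arrival process,
  written as the sum over its jump times.
\<close>

definition profit :: "(real \<Rightarrow> 'w \<Rightarrow> real) \<Rightarrow> real \<Rightarrow> 'w \<Rightarrow> real" where
  "profit \<sigma> T \<omega> =
     (\<Sum>n | arrival n \<omega> \<le> T \<and> effective \<sigma> n \<omega>.
        if 0 < available_before \<sigma> (arrival n \<omega>) \<omega>
        then price (\<sigma> (arrival n \<omega>) \<omega>) - c else 0)"

definition profit_rate :: "(real \<Rightarrow> 'w \<Rightarrow> real) \<Rightarrow> ereal" where
  "profit_rate \<sigma> = Liminf at_top (\<lambda>T. ereal (expectation (profit \<sigma> T) / T))"

definition optimal_policy :: "(real \<Rightarrow> 'w \<Rightarrow> real) \<Rightarrow> bool" where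
  "optimal_policy \<pi> \<longleftrightarrow> policy \<pi> \<and> (\<forall>\<sigma>. policy \<sigma> \<longrightarrow> profit_rate \<sigma> \<le> profit_rate \<pi>)"

end

end

theory Submission
  imports Defs
begin

text \<open>
  Only the potential arrivals are looked at.  There the number of busy units is a controlled chain:
  conditionally on the observations made so far, the current valuation is fresh, and by memorylessness
  so are the residual services and the next gap.  A predictable policy, evaluated at the \<open>n\<close>-th arrival, is a
  function of these observations.  For a suitable function of the number of busy units, the expected
  profit up to time \<open>T\<close> is therefore the expected sum of a drift over the arrivals up to \<open>T\<close>, up to a bounded
  error, and on average \<open>b * T\<close> arrivals occur.  If the drift is at most \<open>h\<close> whatever rate is chosen, then
  \<open>h\<close> bounds the profit rate of every policy; if it equals \<open>g\<close> in all states for a constant rate, then \<open>g\<close> is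
  the profit rate of that static policy.  What remains is an inequality between two explicit functions.
\<close>

text \<open>Conditional expectations are avoided. All sources are carried over to the product of
  their laws, where any coordinate may be replaced by an independent copy without changing an
  integral, and non-anticipation becomes invariance under changes of coordinates that have not been
  observed. The obstacle is a service in progress, which is neither known nor untouched, since its
  age is known; service times are therefore observed censored at the current arrival. Counting
  subsets of the busy units, rather than the units, turns survival up to the next arrival into a
  product over independent services. Two binomial moments are enough, because a function on the
  three states for two units is determined by two coefficients up to a constant, and constants
  cancel. No optimality equation has to be solved over policies: a pointwise bound on the drift
  already bounds every policy. In suitable units both resulting profit rates are functions of the
  static rate alone, so the constant 0.955 enters only through a polynomial inequality in one
  variable.\<close>

context reusable_resource
begin

section \<open>The product space of the sources and resampling of one coordinate\<close>

primrec src :: "source \<Rightarrow> 'w \<Rightarrow> real" where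
  "src (Gap n) = gap n"
| "src (Valuation n) = val n"
| "src (Service n) = service n"
| "src Exogenous = exo"

definition outcome :: "'w \<Rightarrow> source \<Rightarrow> real" where
  "outcome \<omega> s = src s \<omega>"

definition law :: "source \<Rightarrow> real measure" where
  "law s = distr M borel (src s)"

definition path_space :: "(source \<Rightarrow> real) measure" where
  "path_space = (\<Pi>\<^sub>M s\<in>UNIV. law s)"

lemma indep_src: "indep_vars (\<lambda>_. borel) src UNIV"
proof -
  have "(\<lambda>s. case s of Gap n \<Rightarrow> gap n | Valuation n \<Rightarrow> val n | Service n \<Rightarrow> service n
                     | Exogenous \<Rightarrow> exo) = src"
    by (auto simp: fun_eq_iff split: source.split)
  then show ?thesis
    using independent_sources by simp
qed

lemma src_measurable[measurable]: "src s \<in> borel_measurable M"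
  using indep_src by (auto simp: indep_vars_def)

lemma sets_law[simp, measurable_cong]: "sets (law s) = sets borel"
  by (simp add: law_def)

lemma space_law[simp]: "space (law s) = UNIV"
  by (simp add: law_def)

lemma prob_space_law: "prob_space (law s)"
  unfolding law_def by (rule prob_space_distr) simp

lemma prob_space_path: "prob_space path_space"
  unfolding path_space_def by (intro prob_space_PiM prob_space_law)

lemma sets_path[measurable_cong]: "sets path_space = sets (\<Pi>\<^sub>M s\<in>UNIV. borel)"
  unfolding path_space_def by (intro sets_PiM_cong) auto

lemma space_path[simp]: "space path_space = UNIV"
  unfolding path_space_def by (simp add: space_PiM)

lemma coordinate_measurable: "(\<lambda>x. x s) \<in> borel_measurable path_space"
  unfolding path_space_def by (simp add: measurable_cong_sets[OF refl sets_law[symmetric]])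

lemma outcome_measurable[measurable]: "outcome \<in> measurable M path_space"
  unfolding path_space_def outcome_def
  by (rule measurable_PiM_single') (auto simp: measurable_cong_sets[OF refl sets_law])

lemma distr_outcome: "distr M path_space outcome = path_space"
proof -
  have "distr M (\<Pi>\<^sub>M s\<in>UNIV. borel) (\<lambda>\<omega>. \<lambda>s\<in>UNIV. src s \<omega>) = (\<Pi>\<^sub>M s\<in>UNIV. distr M borel (src s))"
    using indep_src by (subst (asm) indep_vars_iff_distr_eq_PiM) auto
  then show ?thesis
    unfolding path_space_def[symmetric] law_def[symmetric]
    by (subst (asm) distr_cong[OF refl sets_path[symmetric], of _ _ outcome])
       (auto simp: outcome_def fun_eq_iff)
qed

lemma integral_outcome:
  "f \<in> borel_measurable path_space \<Longrightarrow> (\<integral>\<omega>. f (outcome \<omega>) \<partial>M) = (\<integral>x. f x \<partial>path_space :: real)"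
  using integral_distr[OF outcome_measurable, of f] by (simp add: distr_outcome)

lemma AE_outcome:
  assumes "AE x in path_space. P x"
  shows "AE \<omega> in M. P (outcome \<omega>)"
  using assms by (subst (asm) distr_outcome[symmetric]) (rule AE_distrD[OF outcome_measurable])

lemma integrable_bounded:
  assumes "f \<in> borel_measurable path_space" "\<And>x. \<bar>f x\<bar> \<le> (B::real)"
  shows "integrable path_space f"
  using assms by (intro finite_measure.integrable_const_bound[of _ _ B]
      prob_space.finite_measure prob_space_path) auto

text \<open>Independence leaves the product law unchanged when coordinate \<open>s\<close> is drawn
  anew, and Fubini lets this draw be integrated first. Thus \<open>g\<close> acts as a conditional
  expectation of \<open>f\<close> given all other coordinates.\<close>

lemma integral_resample:
  fixes f :: "(source \<Rightarrow> real) \<Rightarrow> real"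
  assumes [measurable]: "f \<in> borel_measurable path_space" and bound: "\<And>x. \<bar>f x\<bar> \<le> B"
    and eq: "AE x in path_space. (\<integral>y. f (x(s := y)) \<partial>law s) = g x"
    and [measurable]: "g \<in> borel_measurable path_space"
  shows "(\<integral>x. f x \<partial>path_space) = (\<integral>x. g x \<partial>path_space)"
proof -
  interpret s: prob_space "law s" by (rule prob_space_law)
  interpret path: prob_space path_space by (rule prob_space_path)
  interpret pair: pair_prob_space "law s" path_space ..
  have m: "(\<lambda>(y, x). x(s := y)) \<in> measurable (law s \<Otimes>\<^sub>M path_space) path_space"
    unfolding path_space_def
    by (rule measurable_PiM_single')
       (auto simp: fun_upd_apply case_prod_beta measurable_cong_sets[OF refl sets_law] space_pair_measure
             intro!: measurable_If)
  have d: "distr (law s \<Otimes>\<^sub>M path_space) path_space (\<lambda>(y, x). x(s := y)) = path_space"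
    using distr_pair_PiM_eq_PiM[of UNIV law s] by (simp add: path_space_def prob_space_law)
  have m2: "(\<lambda>z. f ((\<lambda>(y, x). x(s := y)) z)) \<in> borel_measurable (law s \<Otimes>\<^sub>M path_space)"
    by (rule measurable_compose[OF m]) simp
  have m3: "(\<lambda>(x, y). f (x(s := y))) \<in> borel_measurable (path_space \<Otimes>\<^sub>M law s)"
    using measurable_compose[OF measurable_pair_swap' m2] by (simp add: case_prod_beta)
  have "(\<integral>x. f x \<partial>path_space) = (\<integral>z. f ((\<lambda>(y, x). x(s := y)) z) \<partial>(law s \<Otimes>\<^sub>M path_space))"
    by (subst d[symmetric]) (rule integral_distr[OF m], simp)
  also have "\<dots> = (\<integral>(y, x). f (x(s := y)) \<partial>(law s \<Otimes>\<^sub>M path_space))"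
    by (intro Bochner_Integration.integral_cong) auto
  also have "\<dots> = (\<integral>x. (\<integral>y. f (x(s := y)) \<partial>law s) \<partial>path_space)"
    using m2 bound
    by (intro pair.integral_snd[symmetric] finite_measure.integrable_const_bound[where B = B])
       (auto simp: case_prod_beta intro: pair.P.finite_measure_axioms)
  also have "\<dots> = (\<integral>x. g x \<partial>path_space)"
    using eq m3 by (intro integral_cong_AE) (auto intro!: s.borel_measurable_lebesgue_integral)
  finally show ?thesis .
qed

section \<open>Laws of gaps, services and valuations\<close>

lemma law_Gap: "law (Gap n) = density lborel (exponential_density b)"
  using gap_distr[of n] by (simp add: law_def distributed_def cong: distr_cong)

lemma law_Service: "law (Service n) = density lborel (exponential_density \<mu>)"
  using service_distr[of n] by (simp add: law_def distributed_def cong: distr_cong)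

lemma law_Valuation: "law (Valuation n) = uniform_measure lborel {0..b / a}"
  using val_distr[of n] by (simp add: law_def)

lemma integral_of_bool:
  assumes "{x \<in> space N. P x} \<in> sets N"
  shows "(\<integral>x. of_bool (P x) \<partial>N) = measure N {x \<in> space N. P x}"
proof -
  have "(\<integral>x. of_bool (P x) \<partial>N) = (\<integral>x. indicat_real {x \<in> space N. P x} x \<partial>N)"
    by (intro Bochner_Integration.integral_cong) (auto simp: indicator_def)
  then show ?thesis
    using assms by (simp add: Int_absorb2)
qed

lemma service_tail:
  assumes "0 \<le> t"
  shows "(\<integral>y. of_bool (t \<le> y) \<partial>law (Service n)) = exp (- \<mu> * t)"
proof -
  have "AE y in lborel. y \<noteq> t"
    by (rule AE_lborel_singleton)
  then have "AE y in law (Service n). y \<noteq> t"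
    unfolding law_Service by (subst AE_density) auto
  then have "(\<integral>y. of_bool (t \<le> y) \<partial>law (Service n)) = (\<integral>y. of_bool (t < y) \<partial>law (Service n))"
    by (intro integral_cong_AE) auto
  also have "\<dots> = measure (law (Service n)) {t<..}"
    by (subst integral_of_bool) (auto simp: greaterThan_def)
  also have "\<dots> = prob {\<omega> \<in> space M. t < service n \<omega>}"
    unfolding law_def src.simps
    by (subst measure_distr) (auto intro!: arg_cong[where f = prob] simp: src_measurable[of "Service n", simplified])
  also have "\<dots> = exp (- \<mu> * t)"
    using exponential_distributedD_gt[OF service_distr assms service_rate_pos] by (simp add: mult.commute)
  finally show ?thesis .
qed

text \<open>Tilting the density by \<open>exp (- k * y)\<close> gives the exponential density of
  rate \<open>b + k\<close> up to a factor. That factor is the probability that the gap ends before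
  an independent exponential clock of rate \<open>k\<close>.\<close>

lemma gap_laplace:
  assumes "0 \<le> k"
  shows "(\<integral>y. exp (- k * y) \<partial>law (Gap n)) = b / (b + k)"
proof -
  have "(\<integral>y. exp (- k * y) \<partial>law (Gap n)) = (\<integral>y. exponential_density b y * exp (- k * y) \<partial>lborel)"
    unfolding law_Gap using max_rate_pos by (subst integral_density) auto
  also have "\<dots> = (\<integral>y. b / (b + k) * exponential_density (b + k) y \<partial>lborel)"
    using assms max_rate_pos
    by (intro Bochner_Integration.integral_cong)
       (auto simp: exponential_density_def exp_add[symmetric] field_simps)
  also have "\<dots> = b / (b + k) * (\<integral>y. exponential_density (b + k) y \<partial>lborel)"
    by simp
  also have "(\<integral>y. exponential_density (b + k) y \<partial>lborel) = 1"
    using nn_integral_erlang_ith_moment[of "b + k" 0 0] assms max_rate_pos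
    by (intro integral_eq_nn_integral[THEN trans]) auto
  finally show ?thesis
    by simp
qed

lemma valuation_tail:
  assumes "0 \<le> l" "l \<le> b"
  shows "(\<integral>y. of_bool (price l \<le> y) \<partial>law (Valuation n)) = l / b"
proof -
  have p: "0 \<le> price l" "price l \<le> b / a"
    using assms slope_pos by (auto simp: price_def divide_simps)
  have "(\<integral>y. of_bool (price l \<le> y) \<partial>law (Valuation n)) = measure (law (Valuation n)) {price l..}"
    by (subst integral_of_bool) (auto simp: atLeast_def)
  also have "\<dots> = measure lborel ({0..b / a} \<inter> {price l..}) / measure lborel {0..b / a}"
    unfolding law_Valuation using max_rate_pos slope_pos
    by (subst measure_uniform_measure) auto
  also have "{0..b / a} \<inter> {price l..} = {price l..b / a}"
    using p by auto
  also have "measure lborel {price l..b / a} / measure lborel {0..b / a} = l / b"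
    using p max_rate_pos slope_pos by (simp add: price_def field_simps)
  finally show ?thesis .
qed

subsection \<open>Observations at an arrival and memorylessness\<close>

text \<open>The absolute values make the arrival times monotone on every path, not just almost surely.\<close>

definition arr :: "nat \<Rightarrow> (source \<Rightarrow> real) \<Rightarrow> real" where
  "arr n x = (\<Sum>i\<le>n. \<bar>x (Gap i)\<bar>)"

text \<open>Everything visible just before customer \<open>n\<close> is offered a price. The own
  valuation is still hidden, hence \<open>i < n\<close> for valuations but \<open>i \<le> n\<close>
  for gaps. A completed service is known exactly, a running one only through its age; the value 0
  erases what lies in the future.\<close>

definition observed :: "nat \<Rightarrow> (source \<Rightarrow> real) \<Rightarrow> source \<Rightarrow> real" where
  "observed n x s = (case s of
     Gap i \<Rightarrow> if i \<le> n then x (Gap i) else 0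
   | Valuation i \<Rightarrow> if i < n then x (Valuation i) else 0
   | Service i \<Rightarrow> if i < n then min (x (Service i)) (arr n x - arr i x) else 0
   | Exogenous \<Rightarrow> x Exogenous)"

definition freeze :: "nat \<Rightarrow> nat set \<Rightarrow> (source \<Rightarrow> real) \<Rightarrow> source \<Rightarrow> real" where
  "freeze n D x s = (case s of Service m \<Rightarrow> if m \<in> D then arr n x - arr m x else x s | _ \<Rightarrow> x s)"

lemma arr_measurable[measurable]: "arr n \<in> borel_measurable path_space"
  unfolding arr_def[abs_def] by measurable

lemma arr_Suc: "arr (Suc n) x = arr n x + \<bar>x (Gap (Suc n))\<bar>"
  by (simp add: arr_def)

lemma arr_mono: "m \<le> n \<Longrightarrow> arr m x \<le> arr n x"
  unfolding arr_def by (intro sum_mono2) auto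

lemma arr_upd_other[simp]: "(\<And>i. Gap i \<noteq> s) \<Longrightarrow> arr n (x(s := y)) = arr n x"
  by (simp add: arr_def)

lemma arr_upd_later[simp]: "n < k \<Longrightarrow> arr n (x(Gap k := y)) = arr n x"
  by (simp add: arr_def)

lemma measurable_pathI:
  "(\<And>s. (\<lambda>x. f x s) \<in> borel_measurable N) \<Longrightarrow> f \<in> measurable N path_space"
  unfolding path_space_def
  by (rule measurable_PiM_single') (auto simp: measurable_cong_sets[OF refl sets_law])

lemma observed_measurable[measurable]: "observed n \<in> measurable path_space path_space"
proof (rule measurable_pathI)
  show "(\<lambda>x. observed n x s) \<in> borel_measurable path_space" for s
    by (cases s) (simp_all add: observed_def)
qed

lemma freeze_measurable[measurable]: "freeze n D \<in> measurable path_space path_space"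
proof (rule measurable_pathI)
  show "(\<lambda>x. freeze n D x s) \<in> borel_measurable path_space" for s
    by (cases s) (simp_all add: freeze_def)
qed

lemma arr_freeze[simp]: "arr k (freeze n D x) = arr k x"
  by (simp add: arr_def freeze_def)

lemma observedD:
  assumes "observed n x = observed n x'"
  shows "\<And>i. i \<le> n \<Longrightarrow> x (Gap i) = x' (Gap i)"
    and "\<And>i. i < n \<Longrightarrow> x (Valuation i) = x' (Valuation i)"
    and "\<And>i. i < n \<Longrightarrow> min (x (Service i)) (arr n x - arr i x) = min (x' (Service i)) (arr n x' - arr i x')"
    and "x Exogenous = x' Exogenous"
    and "\<And>i. i \<le> n \<Longrightarrow> arr i x = arr i x'"
proof -
  have *: "observed n x s = observed n x' s" for s
    using assms by simp
  show **: "i \<le> n \<Longrightarrow> x (Gap i) = x' (Gap i)" for i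
    using *[of "Gap i"] by (simp add: observed_def)
  show "i < n \<Longrightarrow> x (Valuation i) = x' (Valuation i)" for i
    using *[of "Valuation i"] by (simp add: observed_def)
  show "i < n \<Longrightarrow> min (x (Service i)) (arr n x - arr i x) = min (x' (Service i)) (arr n x' - arr i x')" for i
    using *[of "Service i"] by (simp add: observed_def)
  show "x Exogenous = x' Exogenous"
    using *[of Exogenous] by (simp add: observed_def)
  show "i \<le> n \<Longrightarrow> arr i x = arr i x'" for i
    unfolding arr_def using ** by (intro sum.cong) auto
qed

text \<open>Since \<open>arr k\<close> is at most \<open>arr n\<close>, censoring a service at its
  age at arrival \<open>n\<close> does not alter its comparison with the age at arrival
  \<open>k\<close>. Here it matters that the comparison is not strict.\<close>

lemma observed_service_iff:
  assumes "observed n x = observed n x'" "m < n" "k \<le> n"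
  shows "arr k x \<le> arr m x + x (Service m) \<longleftrightarrow> arr k x' \<le> arr m x' + x' (Service m)"
  using observedD(3)[OF assms(1,2)] observedD(5)[OF assms(1), of k] observedD(5)[OF assms(1), of m]
    observedD(5)[OF assms(1), of n] arr_mono[OF assms(3), of x] assms(2,3)
  by (auto simp: min_def split: if_splits)

text \<open>Censoring at a later age and then at an earlier one is censoring at the earlier one, so
  the observations form a filtration.\<close>

lemma observed_mono:
  assumes "observed n x = observed n x'" "k \<le> n"
  shows "observed k x = observed k x'"
proof
  fix s
  show "observed k x s = observed k x' s"
  proof (cases s)
    case (Service m)
    show ?thesis
    proof (cases "m < k")
      case True
      with assms(2) have "m < n" by simp
      from observedD(3)[OF assms(1) this] have
        "min (min (x (Service m)) (arr n x - arr m x)) (arr k x - arr m x) =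
         min (min (x' (Service m)) (arr n x' - arr m x')) (arr k x' - arr m x')"
        using observedD(5)[OF assms(1), of k] observedD(5)[OF assms(1), of m] assms(2) \<open>m < n\<close> by simp
      then show ?thesis
        using arr_mono[OF assms(2), of x] arr_mono[OF assms(2), of x'] True Service
        by (simp add: observed_def min.assoc min_absorb2)
    qed (simp add: Service observed_def)
  qed (use assms observedD[OF assms(1)] in \<open>auto simp: observed_def\<close>)
qed

lemma observed_freeze:
  assumes "\<And>m. m \<in> D \<Longrightarrow> arr n x \<le> arr m x + x (Service m)"
  shows "observed n (freeze n D x) = observed n x"
proof
  show "observed n (freeze n D x) s = observed n x s" for s
    using assms by (cases s) (force simp: observed_def freeze_def min_def)+
qed

lemma observed_upd:
  assumes "(\<exists>k>n. s = Gap k) \<or> (\<exists>k\<ge>n. s = Valuation k \<or> s = Service k)"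
  shows "observed n (x(s := y)) = observed n x"
proof
  show "observed n (x(s := y)) r = observed n x r" for r
    using assms by (cases r) (auto simp: observed_def)
qed

text \<open>Services in \<open>D\<close> are integrated out one at a time. Neither \<open>h\<close>
  nor any threshold depends on them, so each leaves a factor
  \<open>exp (- \<mu> * \<tau> m x)\<close>, which is absorbed into \<open>h\<close> before the next
  one; this is why the induction generalizes over \<open>h\<close>.\<close>

lemma integral_service_tails:
  fixes h :: "(source \<Rightarrow> real) \<Rightarrow> real" and \<tau> :: "nat \<Rightarrow> (source \<Rightarrow> real) \<Rightarrow> real"
  assumes "finite D"
    and "h \<in> borel_measurable path_space" "\<And>x. 0 \<le> h x \<and> h x \<le> 1"
    and h_upd: "\<And>m x y. m \<in> D \<Longrightarrow> h (x(Service m := y)) = h x"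
    and \<tau>_measurable: "\<And>m. m \<in> D \<Longrightarrow> \<tau> m \<in> borel_measurable path_space"
    and \<tau>_nonneg: "\<And>m x. m \<in> D \<Longrightarrow> 0 \<le> \<tau> m x"
    and \<tau>_upd: "\<And>k m x y. m \<in> D \<Longrightarrow> k \<in> D \<Longrightarrow> \<tau> k (x(Service m := y)) = \<tau> k x"
  shows "(\<integral>x. h x * (\<Prod>m\<in>D. of_bool (\<tau> m x \<le> x (Service m))) \<partial>path_space) =
         (\<integral>x. h x * exp (- \<mu> * (\<Sum>m\<in>D. \<tau> m x)) \<partial>path_space)"
  using assms
proof (induction D arbitrary: h rule: finite_induct)
  case (insert m D)
  note [measurable] = insert.prems(1,4)
  have [measurable]: "\<tau> m \<in> borel_measurable path_space"
    by (auto intro: insert.prems)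
  have [measurable]: "(\<lambda>x. \<Prod>k\<in>E. of_bool (\<tau> k x \<le> x (Service k)) :: real) \<in> borel_measurable path_space"
    if "E = D \<or> E = insert m D" for E
  proof (rule borel_measurable_prod)
    fix k assume "k \<in> E"
    with that have [measurable]: "\<tau> k \<in> borel_measurable path_space"
      by (auto intro: insert.prems)
    have "Measurable.pred path_space (\<lambda>x. \<tau> k x \<le> x (Service k))"
      unfolding pred_def by (rule borel_measurable_le) (simp_all add: coordinate_measurable)
    then show "(\<lambda>x. of_bool (\<tau> k x \<le> x (Service k)) :: real) \<in> borel_measurable path_space"
      by measurable
  qed
  have ne: "k \<noteq> m" if "k \<in> D" for k
    using that insert.hyps by auto
  have h_m: "h (x(Service m := y)) = h x" for x y
    by (rule insert.prems(3)) simp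
  have \<tau>_m: "\<tau> k (x(Service m := y)) = \<tau> k x" if "k = m \<or> k \<in> D" for k x y
    using that by (intro insert.prems(6)) auto
  have prod01: "0 \<le> (\<Prod>k\<in>D. of_bool (P k) :: real) \<and> (\<Prod>k\<in>D. of_bool (P k) :: real) \<le> 1" for P
    by (auto intro!: prod_nonneg prod_le_1)
  have "(\<integral>x. h x * (\<Prod>k\<in>insert m D. of_bool (\<tau> k x \<le> x (Service k))) \<partial>path_space) =
     (\<integral>x. h x * exp (- \<mu> * \<tau> m x) * (\<Prod>k\<in>D. of_bool (\<tau> k x \<le> x (Service k))) \<partial>path_space)"
  proof (rule integral_resample[where B = 1 and s = "Service m"])
    show "\<bar>h x * (\<Prod>k\<in>insert m D. of_bool (\<tau> k x \<le> x (Service k)))\<bar> \<le> 1" for x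
      using insert.prems(2)[of x] insert.hyps prod01[of "\<lambda>k. \<tau> k x \<le> x (Service k)"]
      by (auto simp: abs_mult intro!: mult_le_one)
    show "AE x in path_space. (\<integral>y. h (x(Service m := y)) * (\<Prod>k\<in>insert m D.
          of_bool (\<tau> k (x(Service m := y)) \<le> (x(Service m := y)) (Service k))) \<partial>law (Service m)) =
        h x * exp (- \<mu> * \<tau> m x) * (\<Prod>k\<in>D. of_bool (\<tau> k x \<le> x (Service k)))"
    proof (intro AE_I2)
      fix x
      have "(\<integral>y. h (x(Service m := y)) * (\<Prod>k\<in>insert m D.
          of_bool (\<tau> k (x(Service m := y)) \<le> (x(Service m := y)) (Service k))) \<partial>law (Service m)) =
        (\<integral>y. h x * (\<Prod>k\<in>D. of_bool (\<tau> k x \<le> x (Service k))) * of_bool (\<tau> m x \<le> y) \<partial>law (Service m))"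
        using insert.hyps ne
        by (intro Bochner_Integration.integral_cong refl) (simp add: h_m \<tau>_m mult_ac cong: prod.cong)
      also have "\<dots> = h x * (\<Prod>k\<in>D. of_bool (\<tau> k x \<le> x (Service k))) * exp (- \<mu> * \<tau> m x)"
        using insert.prems(5) by (simp add: service_tail)
      finally show "(\<integral>y. h (x(Service m := y)) * (\<Prod>k\<in>insert m D.
          of_bool (\<tau> k (x(Service m := y)) \<le> (x(Service m := y)) (Service k))) \<partial>law (Service m)) =
        h x * exp (- \<mu> * \<tau> m x) * (\<Prod>k\<in>D. of_bool (\<tau> k x \<le> x (Service k)))"
        by simp
    qed
  qed measurable
  also have "\<dots> = (\<integral>x. h x * exp (- \<mu> * \<tau> m x) * exp (- \<mu> * (\<Sum>k\<in>D. \<tau> k x)) \<partial>path_space)"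
  proof (rule insert.IH)
    show "0 \<le> h x * exp (- \<mu> * \<tau> m x) \<and> h x * exp (- \<mu> * \<tau> m x) \<le> 1" for x
      using insert.prems(2)[of x] insert.prems(5)[of m x] service_rate_pos
      by (auto intro!: mult_le_one)
  qed (use insert.prems in auto)
  also have "\<dots> = (\<integral>x. h x * exp (- \<mu> * (\<Sum>k\<in>insert m D. \<tau> k x)) \<partial>path_space)"
    using insert.hyps by (simp add: exp_add[symmetric] algebra_simps)
  finally show ?case .
qed simp

lemma AE_Gap_pos: "AE y in law (Gap n). 0 < y"
proof -
  have "AE y in lborel. y \<noteq> (0::real)"
    by (rule AE_lborel_singleton)
  then show ?thesis
    unfolding law_Gap by (subst AE_density) (auto simp: exponential_density_def elim!: eventually_mono)
qed

lemma AE_Service_pos: "AE y in law (Service n). 0 < y"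
proof -
  have "AE y in lborel. y \<noteq> (0::real)"
    by (rule AE_lborel_singleton)
  then show ?thesis
    unfolding law_Service by (subst AE_density) (auto simp: exponential_density_def elim!: eventually_mono)
qed

definition regular :: "(source \<Rightarrow> real) \<Rightarrow> bool" where
  "regular x \<longleftrightarrow> (\<forall>n. 0 < x (Gap n) \<and> 0 < x (Service n))"

lemma AE_regular: "AE x in path_space. regular x"
  unfolding regular_def AE_all_countable path_space_def
  using AE_PiM_component[of UNIV law, OF prob_space_law UNIV_I AE_Gap_pos]
    AE_PiM_component[of UNIV law, OF prob_space_law UNIV_I AE_Service_pos]
  by simp

text \<open>
  A customer still in service at arrival \<open>n\<close> has revealed only how long service has lasted so far,
  so replacing the service time by that age does not change the observation, after which the service
  time is independent of everything else in the integrand.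
\<close>

lemma integral_in_service:
  assumes [measurable]: "Measurable.pred path_space Q"
    and Q: "\<And>x x'. observed n x = observed n x' \<Longrightarrow> x (Valuation n) = x' (Valuation n) \<Longrightarrow> Q x = Q x'"
    and D: "D \<subseteq> {..n}" and "n \<le> N"
  shows "(\<integral>x. of_bool (Q x \<and> (\<forall>m\<in>D. arr N x \<le> arr m x + x (Service m))) \<partial>path_space) =
    (\<integral>x. of_bool (Q (freeze n D x)) * exp (- \<mu> * (\<Sum>m\<in>D. arr N x - arr m x)) \<partial>path_space)"
proof -
  have fin: "finite D"
    using D finite_subset by blast
  have "of_bool (Q x \<and> (\<forall>m\<in>D. arr N x \<le> arr m x + x (Service m))) =
    of_bool (Q (freeze n D x)) * (\<Prod>m\<in>D. of_bool (arr N x - arr m x \<le> x (Service m)) :: real)" for x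
  proof (cases "\<forall>m\<in>D. arr N x \<le> arr m x + x (Service m)")
    case True
    have "arr n x \<le> arr m x + x (Service m)" if "m \<in> D" for m
      using True that arr_mono[OF \<open>n \<le> N\<close>, of x] by (meson order_trans)
    then have "Q (freeze n D x) = Q x"
      by (intro Q observed_freeze) (auto simp: freeze_def)
    with True show ?thesis
      by (auto simp: algebra_simps intro!: prod.neutral[symmetric])
  next
    case False
    then obtain m where "m \<in> D" "\<not> arr N x - arr m x \<le> x (Service m)"
      by (auto simp: algebra_simps)
    then have "(\<Prod>m\<in>D. of_bool (arr N x - arr m x \<le> x (Service m)) :: real) = 0"
      using fin by (intro prod_zero) auto
    with False show ?thesis
      by auto
  qed
  then have "(\<integral>x. of_bool (Q x \<and> (\<forall>m\<in>D. arr N x \<le> arr m x + x (Service m))) \<partial>path_space) =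
    (\<integral>x. of_bool (Q (freeze n D x)) * (\<Prod>m\<in>D. of_bool (arr N x - arr m x \<le> x (Service m)) :: real) \<partial>path_space)"
    by simp
  also have "\<dots> = (\<integral>x. of_bool (Q (freeze n D x)) * exp (- \<mu> * (\<Sum>m\<in>D. arr N x - arr m x)) \<partial>path_space)"
  proof (rule integral_service_tails[OF fin])
    fix m x y assume "m \<in> D"
    then have "freeze n D (x(Service m := y)) = freeze n D x"
      by (auto simp: freeze_def fun_eq_iff split: source.split)
    then show "of_bool (Q (freeze n D (x(Service m := y)))) = of_bool (Q (freeze n D x))"
      by simp
  next
    fix m x assume "m \<in> D"
    then show "0 \<le> arr N x - arr m x"
      using D \<open>n \<le> N\<close> arr_mono[of m N x] by auto
  qed auto
  finally show ?thesis .
qed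

text \<open>By \<open>integral_in_service\<close> for \<open>N = n\<close> and
  \<open>N = Suc n\<close>, the two sides differ only in the exponent, by
  \<open>card D * \<mu>\<close> times the next gap. This gap is not part of the observation, so its
  Laplace transform factors out.\<close>

lemma integral_survival:
  assumes [measurable]: "Measurable.pred path_space Q"
    and Q: "\<And>x x'. observed n x = observed n x' \<Longrightarrow> x (Valuation n) = x' (Valuation n) \<Longrightarrow> Q x = Q x'"
    and D: "D \<subseteq> {..n}"
  shows "(\<integral>x. of_bool (Q x \<and> (\<forall>m\<in>D. arr (Suc n) x \<le> arr m x + x (Service m))) \<partial>path_space) =
    b / (b + card D * \<mu>) * (\<integral>x. of_bool (Q x \<and> (\<forall>m\<in>D. arr n x \<le> arr m x + x (Service m))) \<partial>path_space)"
proof -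
  let ?k = "card D * \<mu>"
  have k: "0 \<le> ?k"
    using service_rate_pos by simp
  let ?h = "\<lambda>x. of_bool (Q (freeze n D x)) * exp (- \<mu> * (\<Sum>m\<in>D. arr n x - arr m x))"
  have h: "0 \<le> ?h x \<and> ?h x \<le> 1" for x
    using D service_rate_pos by (auto intro!: mult_nonneg_nonneg sum_nonneg arr_mono)
  have fin: "finite D"
    using D finite_subset by blast
  have "(\<integral>x. of_bool (Q (freeze n D x)) * exp (- \<mu> * (\<Sum>m\<in>D. arr (Suc n) x - arr m x)) \<partial>path_space) =
     (\<integral>x. ?h x * exp (- ?k * \<bar>x (Gap (Suc n))\<bar>) \<partial>path_space)"
    by (intro Bochner_Integration.integral_cong)
      (simp_all add: arr_Suc sum.distrib sum_subtractf exp_add[symmetric] algebra_simps)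
  also have "\<dots> = (\<integral>x. b / (b + ?k) * ?h x \<partial>path_space)"
  proof (rule integral_resample[where B = 1 and s = "Gap (Suc n)"])
    show "\<bar>?h x * exp (- ?k * \<bar>x (Gap (Suc n))\<bar>)\<bar> \<le> 1" for x
    proof -
      have "exp (- ?k * \<bar>x (Gap (Suc n))\<bar>) \<le> 1"
        using k by simp
      then show ?thesis
        using h[of x] by (subst abs_of_nonneg) (auto intro!: mult_le_one mult_nonneg_nonneg)
    qed
    show "AE x in path_space. (\<integral>y. ?h (x(Gap (Suc n) := y)) *
        exp (- ?k * \<bar>(x(Gap (Suc n) := y)) (Gap (Suc n))\<bar>) \<partial>law (Gap (Suc n))) = b / (b + ?k) * ?h x"
    proof (intro AE_I2)
      fix x
      have "?h (x(Gap (Suc n) := y)) = ?h x" for y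
      proof -
        have "freeze n D (x(Gap (Suc n) := y)) = (freeze n D x)(Gap (Suc n) := y)"
          using D by (auto simp: freeze_def fun_eq_iff split: source.split)
        then have "Q (freeze n D (x(Gap (Suc n) := y))) = Q (freeze n D x)"
          by (intro Q) (auto intro: observed_upd)
        moreover have "arr m (x(Gap (Suc n) := y)) = arr m x" if "m \<in> D" for m
          using D that by auto
        ultimately show ?thesis
          by simp
      qed
      then have "(\<integral>y. ?h (x(Gap (Suc n) := y)) *
          exp (- ?k * \<bar>(x(Gap (Suc n) := y)) (Gap (Suc n))\<bar>) \<partial>law (Gap (Suc n))) =
          ?h x * (\<integral>y. exp (- ?k * \<bar>y\<bar>) \<partial>law (Gap (Suc n)))"
        by simp
      also have "(\<integral>y. exp (- ?k * \<bar>y\<bar>) \<partial>law (Gap (Suc n))) = (\<integral>y. exp (- ?k * y) \<partial>law (Gap (Suc n)))"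
      proof (rule integral_cong_AE)
        show "AE y in law (Gap (Suc n)). exp (- ?k * \<bar>y\<bar>) = exp (- ?k * y)"
          using AE_Gap_pos[of "Suc n"] by eventually_elim simp
      qed measurable
      also have "?h x * (\<integral>y. exp (- ?k * y) \<partial>law (Gap (Suc n))) = b / (b + ?k) * ?h x"
        unfolding gap_laplace[OF k] by (rule mult.commute)
      finally show "(\<integral>y. ?h (x(Gap (Suc n) := y)) *
          exp (- ?k * \<bar>(x(Gap (Suc n) := y)) (Gap (Suc n))\<bar>) \<partial>law (Gap (Suc n))) = b / (b + ?k) * ?h x" .
    qed
  qed measurable
  finally show ?thesis
    using integral_in_service[OF assms(1) Q D, of "Suc n"] integral_in_service[OF assms(1) Q D, of n]
    by simp
qed

subsection \<open>Expected number of arrivals\<close>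

text \<open>The density with index \<open>n\<close> belongs to the sum of \<open>n + 1\<close> gaps.
  Summed over all arrivals, these densities give the renewal density, which is constant for a
  Poisson process.\<close>

lemma sums_erlang_density:
  assumes "0 \<le> x"
  shows "(\<lambda>n. erlang_density n b x) sums b"
proof -
  have "(\<lambda>n. b * exp (- b * x) * ((b * x) ^ n /\<^sub>R fact n)) sums (b * exp (- b * x) * exp (b * x))"
    by (intro sums_mult exp_converges)
  moreover have "b * exp (- b * x) * ((b * x) ^ n /\<^sub>R fact n) = erlang_density n b x" for n
    using assms by (simp add: erlang_density_def power_mult_distrib field_simps)
  moreover have "b * exp (- b * x) * exp (b * x) = b"
    by (simp add: exp_minus)
  ultimately show ?thesis
    by (simp only:)
qed

lemma arrival_distr: "distributed M lborel (arrival n) (erlang_density n b)"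
proof -
  have "indep_vars (\<lambda>i. \<Pi>\<^sub>M s\<in>{Gap i}. borel) (\<lambda>i \<omega>. restrict (\<lambda>s. src s \<omega>) {Gap i}) {..n}"
    by (rule indep_vars_restrict[OF indep_src]) (auto simp: disjoint_family_on_def)
  then have "indep_vars (\<lambda>_. borel) (\<lambda>i \<omega>. restrict (\<lambda>s. src s \<omega>) {Gap i} (Gap i)) {..n}"
    by (rule indep_vars_compose2) simp
  then have "indep_vars (\<lambda>_. borel) gap {..n}"
    by simp
  from exponential_distributed_sum[OF _ _ max_rate_pos gap_distr this]
  show ?thesis
    by (simp add: arrival_def[abs_def])
qed

lemma AE_regular_outcome: "AE \<omega> in M. regular (outcome \<omega>)"
  by (rule AE_outcome[OF AE_regular])

lemma arr_outcome: "regular (outcome \<omega>) \<Longrightarrow> arr n (outcome \<omega>) = arrival n \<omega>"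
  unfolding arr_def arrival_def
  by (intro sum.cong) (auto simp: regular_def outcome_def less_imp_le)

lemma arrival_measurable[measurable]: "arrival n \<in> borel_measurable M"
  using distributed_measurable[OF arrival_distr] by simp

lemma sums_prob_arr:
  assumes "0 \<le> T"
  shows "(\<lambda>n. \<integral>x. of_bool (arr n x \<le> T) \<partial>path_space) sums (b * T)"
proof -
  have p: "ennreal (\<integral>x. of_bool (arr n x \<le> T) \<partial>path_space) =
      (\<integral>\<^sup>+t. ennreal (erlang_density n b t) * indicator {0..T} t \<partial>lborel)" for n
  proof -
    have "(\<integral>x. of_bool (arr n x \<le> T) \<partial>path_space) = (\<integral>\<omega>. of_bool (arr n (outcome \<omega>) \<le> T) \<partial>M :: real)"
      by (subst integral_outcome) auto
    also have "\<dots> = (\<integral>\<omega>. of_bool (arrival n \<omega> \<le> T) \<partial>M)"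
      using AE_regular_outcome by (intro integral_cong_AE) (auto simp: arr_outcome)
    also have "\<dots> = prob (arrival n -` {..T} \<inter> space M)"
      by (subst integral_of_bool) (auto intro!: arg_cong[where f = prob])
    finally have "ennreal (\<integral>x. of_bool (arr n x \<le> T) \<partial>path_space) = emeasure M (arrival n -` {..T} \<inter> space M)"
      by (simp add: emeasure_eq_measure)
    also have "\<dots> = (\<integral>\<^sup>+t. ennreal (erlang_density n b t) * indicator {..T} t \<partial>lborel)"
      by (rule distributed_emeasure[OF arrival_distr]) simp
    also have "\<dots> = (\<integral>\<^sup>+t. ennreal (erlang_density n b t) * indicator {0..T} t \<partial>lborel)"
      by (intro nn_integral_cong) (auto simp: erlang_density_def split: split_indicator)
    finally show ?thesis .
  qed
  have "(\<Sum>n. ennreal (\<integral>x. of_bool (arr n x \<le> T) \<partial>path_space)) =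
      (\<integral>\<^sup>+t. (\<Sum>n. ennreal (erlang_density n b t) * indicator {0..T} t) \<partial>lborel)"
    unfolding p by (intro nn_integral_suminf[symmetric]) auto
  also have "\<dots> = (\<integral>\<^sup>+t. ennreal b * indicator {0..T} t \<partial>lborel)"
  proof (intro nn_integral_cong)
    fix t
    show "(\<Sum>n. ennreal (erlang_density n b t) * indicator {0..T} t) = ennreal b * indicator {0..T} t"
    proof (cases "t \<in> {0..T}")
      case True
      then have "(\<lambda>n. ennreal (erlang_density n b t)) sums ennreal b"
        using sums_erlang_density[of t] max_rate_pos by (subst sums_ennreal) auto
      with True show ?thesis
        by (simp add: sums_iff)
    qed simp
  qed
  also have "\<dots> = ennreal (b * T)"
    using assms max_rate_pos by (simp add: nn_integral_cmult ennreal_mult)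
  finally have "(\<lambda>n. ennreal (\<integral>x. of_bool (arr n x \<le> T) \<partial>path_space)) sums ennreal (b * T)"
    by (simp add: sums_iff)
  then show ?thesis
    using assms max_rate_pos by (subst (asm) sums_ennreal) auto
qed

section \<open>Value functions and their drift\<close>

definition present :: "nat set \<Rightarrow> real \<Rightarrow> (source \<Rightarrow> real) \<Rightarrow> nat set" where
  "present E t x = {m \<in> E. t \<le> arr m x + x (Service m)}"

text \<open>
  \<open>post_value\<close> is a combination of the eigenfunctions \<open>k\<close> and \<open>k choose 2\<close> of the pure death process
  with death rates \<open>k * \<mu>\<close>; \<open>pre_value\<close> is chosen so that its mean at the next arrival, started from
  \<open>k\<close> busy units, is \<open>post_value k\<close>.
\<close>

definition post_value :: "real \<Rightarrow> real \<Rightarrow> nat \<Rightarrow> real" where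
  "post_value A G k = A * real k + G * real (k choose 2)"

definition pre_value :: "real \<Rightarrow> real \<Rightarrow> nat \<Rightarrow> real" where
  "pre_value A G k = A * (1 + \<mu> / b) * real k + G * (1 + 2 * \<mu> / b) * real (k choose 2)"

text \<open>The profit intensity \<open>l * (price l - c)\<close> plus the generator of the queue in
  continuous time applied to \<open>post_value\<close>. Departures contribute
  \<open>k * \<mu> * (post_value A G (k - 1) - post_value A G k)\<close>, which is the last term
  because \<open>k * (k - 1)\<close> is twice \<open>k choose 2\<close>.\<close>

definition drift :: "real \<Rightarrow> real \<Rightarrow> nat \<Rightarrow> real \<Rightarrow> real" where
  "drift A G k l = of_bool (k < C) * l * (price l - c + (post_value A G (Suc k) - post_value A G k))
     - \<mu> * (A * real k + 2 * G * real (k choose 2))"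

end

subsection \<open>The embedded chain\<close>

text \<open>
  \<open>rate n\<close> is the rate in force at the arrival of customer \<open>n\<close>, as a function of the path.
\<close>

locale rate_control = reusable_resource +
  fixes rate :: "nat \<Rightarrow> (source \<Rightarrow> real) \<Rightarrow> real"
  assumes rate_measurable[measurable]: "\<And>n. rate n \<in> borel_measurable path_space"
    and rate_nonneg: "\<And>n x. 0 \<le> rate n x"
    and rate_le: "\<And>n x. rate n x \<le> b"
    and rate_observed: "\<And>n x x'. observed n x = observed n x' \<Longrightarrow> rate n x = rate n x'"
begin

definition accepts :: "nat \<Rightarrow> (source \<Rightarrow> real) \<Rightarrow> bool" where
  "accepts n x \<longleftrightarrow> price (rate n x) \<le> x (Valuation n)"

primrec served :: "nat \<Rightarrow> (source \<Rightarrow> real) \<Rightarrow> nat set" where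
  "served 0 x = {}"
| "served (Suc n) x =
     (if accepts n x \<and> card (present (served n x) (arr n x) x) < C
      then insert n (served n x) else served n x)"

definition busy :: "nat \<Rightarrow> (source \<Rightarrow> real) \<Rightarrow> nat" where
  "busy n x = card (present (served n x) (arr n x) x)"

definition busy_after :: "nat \<Rightarrow> (source \<Rightarrow> real) \<Rightarrow> nat" where
  "busy_after n x = card (present (served (Suc n) x) (arr n x) x)"

definition admits :: "nat \<Rightarrow> (source \<Rightarrow> real) \<Rightarrow> bool" where
  "admits n x \<longleftrightarrow> accepts n x \<and> busy n x < C"

lemma served_Suc: "served (Suc n) x = (if admits n x then insert n (served n x) else served n x)"
  by (simp add: admits_def busy_def)

declare served.simps(2)[simp del]

lemma served_iff: "m \<in> served n x \<longleftrightarrow> m < n \<and> admits m x"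
  by (induction n) (auto simp: served_Suc less_Suc_eq)

lemma served_eq: "served n x = {m. m < n \<and> admits m x}"
  by (auto simp: served_iff)

lemma finite_served[simp]: "finite (served n x)"
  by (simp add: served_eq)

lemma finite_present[simp]: "finite E \<Longrightarrow> finite (present E t x)"
  by (simp add: present_def)

lemma busy_after_le_Suc: "busy_after n x \<le> Suc (busy n x)"
proof -
  have "present (served (Suc n) x) (arr n x) x \<subseteq> insert n (present (served n x) (arr n x) x)"
    by (auto simp: present_def served_Suc split: if_splits)
  then have "busy_after n x \<le> card (insert n (present (served n x) (arr n x) x))"
    unfolding busy_after_def by (intro card_mono) auto
  also have "\<dots> \<le> Suc (busy n x)"
    unfolding busy_def by (simp add: card_insert_if)
  finally show ?thesis .
qed

lemma busy_le: "busy n x \<le> C"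
proof (induction n)
  case 0
  show ?case
    by (simp add: busy_def present_def)
next
  case (Suc n)
  have "busy (Suc n) x \<le> busy_after n x"
    unfolding busy_def busy_after_def using arr_mono[of n "Suc n" x]
    by (intro card_mono) (auto simp: present_def)
  also have "\<dots> \<le> C"
  proof (cases "admits n x")
    case True
    then show ?thesis
      using busy_after_le_Suc[of n x] by (simp add: admits_def)
  next
    case False
    then show ?thesis
      using Suc by (simp add: busy_after_def busy_def served_Suc)
  qed
  finally show ?case .
qed

lemma busy_after_eq:
  assumes "regular x"
  shows "busy_after n x = busy n x + of_bool (admits n x)"
proof -
  have "0 \<le> x (Service n)"
    using assms by (auto simp: regular_def less_imp_le)
  then have "present (insert n (served n x)) (arr n x) x = insert n (present (served n x) (arr n x) x)"
    by (auto simp: present_def)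
  moreover have "n \<notin> present (served n x) (arr n x) x"
    by (simp add: present_def served_iff)
  ultimately show ?thesis
    by (simp add: busy_after_def busy_def served_Suc)
qed

text \<open>Each earlier admission is decided by a rate that is a function of an earlier
  observation, a valuation already seen and the earlier number of busy units; who is still present
  at arrival \<open>k\<close> can be read off the censored services.\<close>

lemma served_observed:
  assumes obs: "observed n x = observed n x'"
  shows "k \<le> n \<Longrightarrow> served k x = served k x' \<and> busy k x = busy k x'"
proof (induction k rule: less_induct)
  case (less k)
  have "admits m x = admits m x'" if "m < k" for m
  proof -
    have "rate m x = rate m x'"
      using that less.prems by (intro rate_observed observed_mono[OF obs]) auto
    moreover have "x (Valuation m) = x' (Valuation m)"
      using that less.prems by (intro observedD(2)[OF obs]) auto
    ultimately show ?thesis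
      using less.IH[OF that] less.prems that by (simp add: admits_def accepts_def)
  qed
  then have *: "served k x = served k x'"
    by (auto simp: served_eq)
  moreover have "present (served k x) (arr k x) x = present (served k x) (arr k x') x'"
    using observed_service_iff[OF obs _ less.prems] less.prems
    by (auto simp: present_def served_iff)
  ultimately show ?case
    by (simp add: busy_def)
qed

lemma busy_observed: "observed n x = observed n x' \<Longrightarrow> busy n x = busy n x'"
  using served_observed by blast

lemma served_Suc_observed:
  assumes "observed n x = observed n x'" "x (Valuation n) = x' (Valuation n)"
  shows "served (Suc n) x = served (Suc n) x'"
  using assms served_observed[OF assms(1), of n] rate_observed[OF assms(1)]
  by (simp add: served_Suc admits_def accepts_def)

lemma accepts_measurable[measurable]: "Measurable.pred path_space (accepts n)"
  unfolding accepts_def[abs_def] pred_def price_def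
  by (rule borel_measurable_le) (simp_all add: coordinate_measurable)

lemma measurable_nat_ofI:
  fixes f :: "'z \<Rightarrow> nat"
  assumes "(\<lambda>x. real (f x)) \<in> borel_measurable N"
  shows "f \<in> measurable N (count_space UNIV)"
proof (subst measurable_count_space_eq2_countable)
  have "f -` {k} \<inter> space N = (\<lambda>x. real (f x)) -` {real k} \<inter> space N" for k
    by auto
  then show "f \<in> space N \<rightarrow> UNIV \<and> (\<forall>k\<in>UNIV. f -` {k} \<inter> space N \<in> sets N)"
    using measurable_sets[OF assms, of "{real _}"] by auto
qed

lemma pred_in_service[measurable]: "Measurable.pred path_space (\<lambda>x. arr n x \<le> arr m x + x (Service m))"
  unfolding pred_def
  by (rule borel_measurable_le) (auto intro!: borel_measurable_add simp: coordinate_measurable)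

lemma card_present: "finite E \<Longrightarrow> real (card (present E t x)) = (\<Sum>m\<in>E. of_bool (t \<le> arr m x + x (Service m)))"
  unfolding present_def by (simp add: sum.inter_filter[symmetric] of_bool_def)

text \<open>The two claims need each other: \<open>busy n\<close> is a sum over earlier admissions,
  and \<open>admits n\<close> is defined through \<open>busy n\<close>.\<close>

lemma busy_admits_measurable:
  "busy n \<in> measurable path_space (count_space UNIV) \<and> Measurable.pred path_space (admits n)"
proof (induction n rule: less_induct)
  case (less n)
  have "real (busy n x) = (\<Sum>m<n. of_bool (admits m x \<and> arr n x \<le> arr m x + x (Service m)))" for x
  proof -
    have "real (busy n x) = (\<Sum>m\<in>{m \<in> {..<n}. admits m x}. of_bool (arr n x \<le> arr m x + x (Service m)))"
      unfolding busy_def by (subst card_present) (simp_all add: served_eq lessThan_def)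
    also have "\<dots> = (\<Sum>m<n. of_bool (admits m x \<and> arr n x \<le> arr m x + x (Service m)))"
      by (subst sum.inter_filter) (auto intro!: sum.cong simp del: sum_of_bool_eq)
    finally show ?thesis .
  qed
  moreover have "(\<lambda>x. \<Sum>m<n. of_bool (admits m x \<and> arr n x \<le> arr m x + x (Service m)) :: real)
      \<in> borel_measurable path_space"
  proof (rule borel_measurable_sum)
    fix m assume "m \<in> {..<n}"
    then have [measurable]: "Measurable.pred path_space (admits m)"
      using less by simp
    show "(\<lambda>x. of_bool (admits m x \<and> arr n x \<le> arr m x + x (Service m)) :: real) \<in> borel_measurable path_space"
      by measurable
  qed
  ultimately have [measurable]: "busy n \<in> measurable path_space (count_space UNIV)"
    by (intro measurable_nat_ofI) simp
  have "Measurable.pred path_space (admits n)"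
    unfolding admits_def[abs_def] by measurable
  then show ?case
    by simp
qed

lemmas busy_measurable[measurable] = busy_admits_measurable[THEN conjunct1]
  and admits_measurable[measurable] = busy_admits_measurable[THEN conjunct2]

lemma pred_served[measurable]: "Measurable.pred path_space (\<lambda>x. m \<in> served n x)"
  unfolding served_iff by measurable

text \<open>This sum ranges over a family of sets that does not depend on \<open>B\<close>. For a
  random \<open>B\<close> it can be exchanged with the integral, which reduces binomial moments to
  the survival of fixed sets.\<close>

lemma binomial_card_eq_sum:
  assumes "finite F" "B \<subseteq> F"
  shows "real (card B choose j) = (\<Sum>D | D \<subseteq> F \<and> card D = j. of_bool (D \<subseteq> B))"
proof -
  have "real (card B choose j) = card {D. D \<subseteq> B \<and> card D = j}"
    using assms by (subst n_subsets) (auto intro: finite_subset)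
  also have "{D. D \<subseteq> B \<and> card D = j} = {D \<in> {D. D \<subseteq> F \<and> card D = j}. D \<subseteq> B}"
    using assms by auto
  also have "real (card \<dots>) = (\<Sum>D | D \<subseteq> F \<and> card D = j. of_bool (D \<subseteq> B))"
    using assms by (simp add: sum.inter_filter[symmetric] of_bool_def)
  finally show ?thesis .
qed

text \<open>A fixed set of \<open>j\<close> customers survives as a whole until the next arrival
  with probability \<open>b / (b + j * \<mu>)\<close>, the same for all such sets. The binomial
  moments are therefore eigenfunctions of the transition between arrivals.\<close>

lemma integral_busy_choose:
  "(\<integral>x. of_bool (arr n x \<le> T) * real (busy (Suc n) x choose j) \<partial>path_space) =
   b / (b + j * \<mu>) * (\<integral>x. of_bool (arr n x \<le> T) * real (busy_after n x choose j) \<partial>path_space)"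
proof -
  let ?\<D> = "{D. D \<subseteq> {..n} \<and> card D = j}"
  let ?I = "\<lambda>N D x. of_bool ((arr n x \<le> T \<and> D \<subseteq> served (Suc n) x) \<and> (\<forall>m\<in>D. arr N x \<le> arr m x + x (Service m))) :: real"
  have [simp]: "finite ?\<D>"
    by (rule finite_subset[of _ "Pow {..n}"]) auto
  have fin: "finite D" if "D \<in> ?\<D>" for D
    using that finite_subset[of D "{..n}"] by auto
  have eq: "of_bool (arr n x \<le> T) * real (card (present (served (Suc n) x) (arr N x) x) choose j) = (\<Sum>D\<in>?\<D>. ?I N D x)" for N x
  proof -
    have "present (served (Suc n) x) (arr N x) x \<subseteq> {..n}"
      by (auto simp: present_def served_iff)
    from binomial_card_eq_sum[OF finite_atMost this, of j]
    have "of_bool (arr n x \<le> T) * real (card (present (served (Suc n) x) (arr N x) x) choose j) =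
      (\<Sum>D\<in>?\<D>. of_bool (arr n x \<le> T) * of_bool (D \<subseteq> present (served (Suc n) x) (arr N x) x))"
      by (simp add: sum_distrib_left)
    also have "\<dots> = (\<Sum>D\<in>?\<D>. ?I N D x)"
      by (intro sum.cong) (auto simp: present_def)
    finally show ?thesis .
  qed
  have meas: "Measurable.pred path_space (\<lambda>x. arr n x \<le> T \<and> D \<subseteq> served (Suc n) x)" if "D \<in> ?\<D>" for D
    unfolding subset_eq using fin[OF that] by measurable
  have meas_I: "?I N D \<in> borel_measurable path_space" if "D \<in> ?\<D>" for N D
  proof -
    note [measurable] = meas[OF that]
    show ?thesis
      using fin[OF that] by measurable
  qed
  have int: "integrable path_space (?I N D)" if "D \<in> ?\<D>" for N D
    by (rule integrable_bounded[of _ 1]) (use meas_I[OF that] in auto)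
  have "(\<integral>x. of_bool (arr n x \<le> T) * real (busy (Suc n) x choose j) \<partial>path_space) = (\<Sum>D\<in>?\<D>. \<integral>x. ?I (Suc n) D x \<partial>path_space)"
    unfolding busy_def eq by (rule Bochner_Integration.integral_sum) (rule int)
  also have "\<dots> = (\<Sum>D\<in>?\<D>. b / (b + j * \<mu>) * (\<integral>x. ?I n D x \<partial>path_space))"
  proof (rule sum.cong[OF refl])
    fix D assume D: "D \<in> ?\<D>"
    have "(\<integral>x. ?I (Suc n) D x \<partial>path_space) = b / (b + card D * \<mu>) * (\<integral>x. ?I n D x \<partial>path_space)"
    proof (rule integral_survival[OF meas[OF D]])
      fix x x' assume "observed n x = observed n x'" "x (Valuation n) = x' (Valuation n)"
      then show "(arr n x \<le> T \<and> D \<subseteq> served (Suc n) x) = (arr n x' \<le> T \<and> D \<subseteq> served (Suc n) x')"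
        using served_Suc_observed[of n x x'] observedD(5)[of n x x' n] by simp
    qed (use D in auto)
    then show "(\<integral>x. ?I (Suc n) D x \<partial>path_space) = b / (b + j * \<mu>) * (\<integral>x. ?I n D x \<partial>path_space)"
      using D by simp
  qed
  also have "\<dots> = b / (b + j * \<mu>) * (\<integral>x. (\<Sum>D\<in>?\<D>. ?I n D x) \<partial>path_space)"
    by (subst Bochner_Integration.integral_sum[OF int]) (simp_all only: sum_distrib_left)
  also have "(\<integral>x. (\<Sum>D\<in>?\<D>. ?I n D x) \<partial>path_space) = (\<integral>x. of_bool (arr n x \<le> T) * real (busy_after n x choose j) \<partial>path_space)"
    unfolding busy_after_def eq ..
  finally show ?thesis .
qed

text \<open>The valuation of customer \<open>n\<close> is not part of observation \<open>n\<close>,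
  so it is fresh for both \<open>f\<close> and the rate, and its tail at the quoted price is
  \<open>rate n x / b\<close>.\<close>

lemma integral_accepts:
  assumes [measurable]: "f \<in> borel_measurable path_space" and bound: "\<And>x. \<bar>f x\<bar> \<le> B"
    and upd: "\<And>x y. f (x(Valuation n := y)) = f x"
  shows "(\<integral>x. f x * of_bool (accepts n x) \<partial>path_space) = (\<integral>x. f x * (rate n x / b) \<partial>path_space)"
proof (rule integral_resample[where s = "Valuation n" and B = B])
  show "\<bar>f x * of_bool (accepts n x)\<bar> \<le> B" for x
    using bound[of x] by auto
  have "rate n (x(Valuation n := y)) = rate n x" for x y
    by (intro rate_observed observed_upd) auto
  then show "AE x in path_space.
      (\<integral>y. f (x(Valuation n := y)) * of_bool (accepts n (x(Valuation n := y))) \<partial>law (Valuation n)) =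
      f x * (rate n x / b)"
    by (intro AE_I2) (simp add: upd accepts_def valuation_tail[OF rate_nonneg rate_le])
qed measurable

end

text \<open>Once the gate \<open>p\<close> closes it stays closed, so the sum telescopes up to that
  moment. The conjunct \<open>p N \<longrightarrow> m = N\<close> carries the induction: as long as
  the gate is open, the end point is the current index.\<close>

lemma sum_gated_telescope:
  fixes w :: "nat \<Rightarrow> real"
  assumes "\<And>n. p (Suc n) \<Longrightarrow> p n"
  shows "\<exists>m. (\<Sum>n<N. of_bool (p n) * (w (Suc n) - w n)) = w m - w 0 \<and> (p N \<longrightarrow> m = N)"
proof (induction N)
  case 0
  show ?case by auto
next
  case (Suc N)
  then obtain m where m: "(\<Sum>n<N. of_bool (p n) * (w (Suc n) - w n)) = w m - w 0" "p N \<longrightarrow> m = N"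
    by blast
  show ?case
  proof (cases "p N")
    case True
    then show ?thesis
      using m by (intro exI[of _ "Suc N"]) auto
  next
    case False
    then show ?thesis
      using m assms[of N] by (intro exI[of _ m]) auto
  qed
qed

section \<open>The Poisson equation and bounds on the total reward\<close>

context rate_control
begin

definition reward :: "real \<Rightarrow> nat \<Rightarrow> (source \<Rightarrow> real) \<Rightarrow> real" where
  "reward T n x = of_bool (arr n x \<le> T \<and> admits n x) * (price (rate n x) - c)"

text \<open>A crude bound by the sum over all states. The range reaches \<open>Suc C\<close> to
  match the bound \<open>busy_after_le_Suc\<close>, which holds on every path.\<close>

lemma abs_fun_of_busy_le:
  fixes h :: "nat \<Rightarrow> real"
  assumes "k \<le> Suc C"
  shows "\<bar>h k\<bar> \<le> (\<Sum>j\<le>Suc C. \<bar>h j\<bar>)"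
  using assms by (intro member_le_sum) auto

lemma integrable_fun_of_busy:
  fixes h :: "nat \<Rightarrow> real"
  shows "integrable path_space (\<lambda>x. of_bool (arr n x \<le> T) * h (busy k x))"
proof (rule integrable_bounded[where B = "\<Sum>j\<le>Suc C. \<bar>h j\<bar>"])
  show "\<bar>of_bool (arr n x \<le> T) * h (busy k x)\<bar> \<le> (\<Sum>j\<le>Suc C. \<bar>h j\<bar>)" for x
    using abs_fun_of_busy_le[of "busy k x" h] busy_le[of k x] by (auto simp: abs_mult intro: sum_nonneg)
qed measurable

lemma price_minus_cost_bound: "0 \<le> l \<Longrightarrow> l \<le> b \<Longrightarrow> \<bar>price l - c\<bar> \<le> b / a + c"
  using slope_pos cost_pos by (auto simp: price_def abs_le_iff field_simps)

lemma reward_bound: "\<bar>reward T n x\<bar> \<le> (b / a + c) * of_bool (arr n x \<le> T)"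
  using price_minus_cost_bound[OF rate_nonneg rate_le, of n x] by (auto simp: reward_def)

lemma price_rate_measurable[measurable]: "(\<lambda>x. price (rate n x)) \<in> borel_measurable path_space"
  unfolding price_def by measurable

lemma reward_measurable[measurable]: "reward T n \<in> borel_measurable path_space"
  unfolding reward_def[abs_def] by measurable

lemma integrable_reward: "integrable path_space (reward T n)"
proof (rule integrable_bounded[where B = "b / a + c"])
  have "0 \<le> b / a + c"
    using max_rate_pos slope_pos cost_pos by simp
  then show "\<bar>reward T n x\<bar> \<le> b / a + c" for x
    using reward_bound[of T n x] by (cases "arr n x \<le> T") auto
qed measurable

lemma integrable_arr_le: "integrable path_space (\<lambda>x. of_bool (arr n x \<le> T) :: real)"
  by (rule integrable_bounded[where B = 1]) auto

lemma busy_after_measurable[measurable]: "busy_after n \<in> measurable path_space (count_space UNIV)"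
proof (rule measurable_nat_ofI)
  have "real (busy_after n x) =
    (\<Sum>m\<le>n. of_bool (m \<in> served (Suc n) x \<and> arr n x \<le> arr m x + x (Service m)))" for x
  proof -
    have "present (served (Suc n) x) (arr n x) x =
      {m \<in> {..n}. m \<in> served (Suc n) x \<and> arr n x \<le> arr m x + x (Service m)}"
      by (auto simp: present_def served_iff)
    then show ?thesis
      by (simp add: busy_after_def Int_def)
  qed
  then show "(\<lambda>x. real (busy_after n x)) \<in> borel_measurable path_space"
    by (simp del: sum_of_bool_eq)
qed

lemma integrable_fun_of_busy_after:
  fixes h :: "nat \<Rightarrow> real"
  shows "integrable path_space (\<lambda>x. of_bool (arr n x \<le> T) * h (busy_after n x))"
proof (rule integrable_bounded[where B = "\<Sum>j\<le>Suc C. \<bar>h j\<bar>"])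
  show "\<bar>of_bool (arr n x \<le> T) * h (busy_after n x)\<bar> \<le> (\<Sum>j\<le>Suc C. \<bar>h j\<bar>)" for x
    using abs_fun_of_busy_le[of "busy_after n x" h] busy_after_le_Suc[of n x] busy_le[of n x]
    by (auto simp: abs_mult intro: sum_nonneg)
qed measurable

text \<open>The factors \<open>1 + \<mu> / b\<close> and \<open>1 + 2 * \<mu> / b\<close> in
  \<open>pre_value\<close> are the inverses of the survival factors for one and for two
  units.\<close>

lemma integral_pre_value:
  "(\<integral>x. of_bool (arr n x \<le> T) * pre_value A G (busy (Suc n) x) \<partial>path_space) =
   (\<integral>x. of_bool (arr n x \<le> T) * post_value A G (busy_after n x) \<partial>path_space)"
proof -
  have linear: "(\<integral>x. p * f x + q * g x \<partial>path_space) =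
      p * (\<integral>x. f x \<partial>path_space) + q * (\<integral>x. g x \<partial>path_space)"
    if "integrable path_space f" "integrable path_space g"
    for p q :: real and f g :: "(source \<Rightarrow> real) \<Rightarrow> real"
    using that by simp
  have "(\<integral>x. of_bool (arr n x \<le> T) * pre_value A G (busy (Suc n) x) \<partial>path_space) =
    A * (1 + \<mu> / b) * (\<integral>x. of_bool (arr n x \<le> T) * real (busy (Suc n) x choose 1) \<partial>path_space) +
    G * (1 + 2 * \<mu> / b) * (\<integral>x. of_bool (arr n x \<le> T) * real (busy (Suc n) x choose 2) \<partial>path_space)"
    by (subst linear[symmetric, OF integrable_fun_of_busy[where h = "\<lambda>k. real (k choose 1)"]
          integrable_fun_of_busy[where h = "\<lambda>k. real (k choose 2)"]])
       (auto simp: pre_value_def algebra_simps intro!: Bochner_Integration.integral_cong)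
  also have "\<dots> = A * (\<integral>x. of_bool (arr n x \<le> T) * real (busy_after n x choose 1) \<partial>path_space) +
    G * (\<integral>x. of_bool (arr n x \<le> T) * real (busy_after n x choose 2) \<partial>path_space)"
  proof -
    have "(1 + k * \<mu> / b) * (b / (b + k * \<mu>)) = 1" if "0 \<le> k" for k
    proof -
      have "0 < b + k * \<mu>"
        using max_rate_pos service_rate_pos that by (simp add: add_pos_nonneg)
      moreover have "1 + k * \<mu> / b = (b + k * \<mu>) / b"
        using max_rate_pos by (simp add: field_simps)
      ultimately show ?thesis
        using max_rate_pos by simp
    qed
    note this[of 1] this[of 2]
    then have "(1 + \<mu> / b) * (b / (b + real 1 * \<mu>)) = 1" "(1 + 2 * \<mu> / b) * (b / (b + real 2 * \<mu>)) = 1"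
      by (simp_all only: mult_1 of_nat_1 of_nat_numeral zero_le_one zero_le_numeral)
    then show ?thesis
      unfolding integral_busy_choose by (simp only: mult.assoc[symmetric] mult.right_neutral) (simp only: mult.assoc mult.right_neutral)
  qed
  also have "\<dots> = (\<integral>x. of_bool (arr n x \<le> T) * post_value A G (busy_after n x) \<partial>path_space)"
    by (subst linear[symmetric, OF integrable_fun_of_busy_after[where h = "\<lambda>k. real (k choose 1)"]
          integrable_fun_of_busy_after[where h = "\<lambda>k. real (k choose 2)"]])
       (auto simp: post_value_def algebra_simps intro!: Bochner_Integration.integral_cong)
  finally show ?thesis .
qed

lemma drift_measurable[measurable]: "(\<lambda>x. drift A G (busy n x) (rate n x)) \<in> borel_measurable path_space"
proof -
  have "(\<lambda>x. drift A G k (rate n x)) \<in> borel_measurable path_space" for k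
    unfolding drift_def by measurable
  then show ?thesis
    by (rule measurable_compose_countable) measurable
qed

text \<open>On regular paths, reward plus new \<open>post_value\<close> equals the old
  \<open>post_value\<close> plus a gain on acceptance. Averaging over the valuation replaces
  acceptance by \<open>rate n x / b\<close>, and averaging over the next gap turns the new
  \<open>post_value\<close> into \<open>pre_value\<close> at the next arrival. The drift is divided
  by \<open>b\<close> because \<open>1 / b\<close> is the mean gap.\<close>

lemma poisson_equation:
  "(\<integral>x. reward T n x \<partial>path_space) =
   (\<integral>x. of_bool (arr n x \<le> T) * drift A G (busy n x) (rate n x) \<partial>path_space) / b -
   (\<integral>x. of_bool (arr n x \<le> T) * (pre_value A G (busy (Suc n) x) - pre_value A G (busy n x)) \<partial>path_space)"
proof -
  let ?I = "\<lambda>x. of_bool (arr n x \<le> T) :: real"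
  let ?d = "\<lambda>k. post_value A G (Suc k) - post_value A G k"
  let ?f = "\<lambda>x. ?I x * (of_bool (busy n x < C) * (price (rate n x) - c + ?d (busy n x)))"
  define B where "B = b / a + c + (\<Sum>j\<le>Suc C. \<bar>?d j\<bar>)"
  have f_bound: "\<bar>?f x\<bar> \<le> B" for x
  proof -
    have "\<bar>price (rate n x) - c\<bar> \<le> b / a + c"
      by (rule price_minus_cost_bound[OF rate_nonneg rate_le])
    moreover have "\<bar>?d (busy n x)\<bar> \<le> (\<Sum>j\<le>Suc C. \<bar>?d j\<bar>)"
      using busy_le[of n x] by (intro abs_fun_of_busy_le[where h = ?d]) simp
    ultimately have "\<bar>price (rate n x) - c + ?d (busy n x)\<bar> \<le> B"
      unfolding B_def by linarith
    moreover from this have "0 \<le> B"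
      by (rule order_trans[OF abs_ge_zero])
    ultimately show ?thesis
      by auto
  qed
  have f_measurable[measurable]: "?f \<in> borel_measurable path_space"
    by measurable
  have f_int: "integrable path_space ?f"
    by (rule integrable_bounded[OF f_measurable f_bound])
  have fa_int: "integrable path_space (\<lambda>x. ?f x * of_bool (accepts n x))"
  proof (rule integrable_bounded[where B = B])
    show "\<bar>?f x * of_bool (accepts n x)\<bar> \<le> B" for x
      using f_bound[of x] by (cases "accepts n x") auto
  qed measurable
  have fr_int: "integrable path_space (\<lambda>x. ?f x * (rate n x / b))"
  proof (rule integrable_bounded[where B = B])
    show "\<bar>?f x * (rate n x / b)\<bar> \<le> B" for x
      unfolding abs_mult using f_bound[of x] rate_nonneg[of n x] rate_le[of n x] max_rate_pos
        mult_left_le[of "\<bar>rate n x / b\<bar>" "\<bar>?f x\<bar>"] by (simp add: abs_mult)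
  qed measurable
  \<comment> \<open>In state \<open>k\<close>, \<open>pre_value\<close> exceeds
    \<open>post_value\<close> by
    \<open>\<mu> / b * (A * real k + 2 * G * real (k choose 2))\<close>, which is the departure term
    of \<open>drift\<close> divided by \<open>b\<close>.\<close>
  have decomposition: "?I x * post_value A G (busy n x) + ?f x * (rate n x / b) =
      ?I x * drift A G (busy n x) (rate n x) / b + ?I x * pre_value A G (busy n x)" for x
    using max_rate_pos
    by (auto simp: drift_def pre_value_def post_value_def[of A G "busy n _"] field_simps)
  have "?f (x(Valuation n := y)) = ?f x" for x y
  proof -
    have "observed n (x(Valuation n := y)) = observed n x"
      by (rule observed_upd) simp
    from busy_observed[OF this] rate_observed[OF this] show ?thesis
      by simp
  qed
  then have purchase: "(\<integral>x. ?f x * of_bool (accepts n x) \<partial>path_space) = (\<integral>x. ?f x * (rate n x / b) \<partial>path_space)"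
    by (rule integral_accepts[OF f_measurable f_bound])
  have "(\<integral>x. reward T n x \<partial>path_space) + (\<integral>x. ?I x * pre_value A G (busy (Suc n) x) \<partial>path_space) =
    (\<integral>x. reward T n x + ?I x * post_value A G (busy_after n x) \<partial>path_space)"
    unfolding integral_pre_value
    by (rule Bochner_Integration.integral_add[OF integrable_reward integrable_fun_of_busy_after, symmetric])
  also have "\<dots> = (\<integral>x. ?I x * post_value A G (busy n x) + ?f x * of_bool (accepts n x) \<partial>path_space)"
  proof (rule integral_cong_AE)
    show "AE x in path_space. reward T n x + ?I x * post_value A G (busy_after n x) =
        ?I x * post_value A G (busy n x) + ?f x * of_bool (accepts n x)"
      using AE_regular by eventually_elim (auto simp: busy_after_eq reward_def admits_def algebra_simps)
  qed measurable
  also have "\<dots> = (\<integral>x. ?I x * post_value A G (busy n x) \<partial>path_space) + (\<integral>x. ?f x * (rate n x / b) \<partial>path_space)"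
    by (simp only: Bochner_Integration.integral_add[OF integrable_fun_of_busy fa_int] purchase)
  also have "\<dots> = (\<integral>x. ?I x * post_value A G (busy n x) + ?f x * (rate n x / b) \<partial>path_space)"
    by (rule Bochner_Integration.integral_add[OF integrable_fun_of_busy fr_int, symmetric])
  also have "\<dots> = (\<integral>x. ?I x * drift A G (busy n x) (rate n x) / b + ?I x * pre_value A G (busy n x) \<partial>path_space)"
    by (simp only: decomposition)
  also have "\<dots> = (\<integral>x. ?I x * drift A G (busy n x) (rate n x) / b \<partial>path_space) +
      (\<integral>x. ?I x * pre_value A G (busy n x) \<partial>path_space)"
  proof (rule Bochner_Integration.integral_add[OF _ integrable_fun_of_busy])
    have "integrable path_space (\<lambda>x. ?I x * post_value A G (busy n x) + ?f x * (rate n x / b) - ?I x * pre_value A G (busy n x))"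
      by (intro Bochner_Integration.integrable_diff Bochner_Integration.integrable_add integrable_fun_of_busy fr_int)
    then show "integrable path_space (\<lambda>x. ?I x * drift A G (busy n x) (rate n x) / b)"
      by (simp only: decomposition add_diff_cancel_right')
  qed
  finally show ?thesis
    by (simp add: right_diff_distrib integrable_fun_of_busy)
qed

text \<open>Summed over the arrivals up to \<open>T\<close>, whose expected number is
  \<open>b * T\<close>, the drift terms compare with \<open>g * T\<close>, while the increments of
  \<open>pre_value\<close> telescope to a difference of two values. The error \<open>2 * W\<close>
  does not depend on \<open>T\<close>, so it disappears from the long-run average.\<close>

lemma reward_sum_bounds:
  fixes A G g :: real
  assumes "0 \<le> T"
  defines "W \<equiv> \<Sum>j\<le>Suc C. \<bar>pre_value A G j\<bar>"
  shows "(\<And>k l. k \<le> C \<Longrightarrow> 0 \<le> l \<Longrightarrow> l \<le> b \<Longrightarrow> drift A G k l \<le> g) \<Longrightarrow>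
      (\<Sum>n. \<integral>x. reward T n x \<partial>path_space) \<le> g * T + 2 * W"
    and "(\<And>n x. g \<le> drift A G (busy n x) (rate n x)) \<Longrightarrow>
      g * T - 2 * W \<le> (\<Sum>n. \<integral>x. reward T n x \<partial>path_space)"
    and "summable (\<lambda>n. \<integral>x. \<bar>reward T n x\<bar> \<partial>path_space)"
proof -
  let ?p = "\<lambda>n. \<integral>x. of_bool (arr n x \<le> T) \<partial>path_space :: real"
  note p = sums_prob_arr[OF assms(1)]
  show abs_summable: "summable (\<lambda>n. \<integral>x. \<bar>reward T n x\<bar> \<partial>path_space)"
  proof (rule summable_comparison_test)
    show "summable (\<lambda>n. (b / a + c) * ?p n)"
      using p by (intro summable_mult) (rule sums_summable)
    have "(\<integral>x. \<bar>reward T n x\<bar> \<partial>path_space) \<le> (\<integral>x. (b / a + c) * of_bool (arr n x \<le> T) \<partial>path_space)" for n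
      by (intro integral_mono integrable_abs integrable_reward integrable_mult_right integrable_arr_le reward_bound)
    then show "\<exists>N. \<forall>n\<ge>N. norm (\<integral>x. \<bar>reward T n x\<bar> \<partial>path_space) \<le> (b / a + c) * ?p n"
      by (auto simp: integrable_arr_le)
  qed
  have "summable (\<lambda>n. \<integral>x. reward T n x \<partial>path_space)"
    by (rule summable_comparison_test[OF _ abs_summable]) (auto intro: integral_abs_bound)
  then have lim: "(\<lambda>N. \<Sum>n<N. \<integral>x. reward T n x \<partial>path_space) \<longlonglongrightarrow> (\<Sum>n. \<integral>x. reward T n x \<partial>path_space)"
    by (rule summable_LIMSEQ)
  have plim: "(\<lambda>N. g / b * (\<Sum>n<N. ?p n) + v) \<longlonglongrightarrow> g * T + v" for v
  proof -
    have "(\<lambda>N. g / b * (\<Sum>n<N. ?p n) + v) \<longlonglongrightarrow> g / b * (b * T) + v"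
      using p by (intro tendsto_intros) (simp add: sums_def)
    then show ?thesis
      using max_rate_pos by simp
  qed
  let ?w = "\<lambda>n x. of_bool (arr n x \<le> T) * (pre_value A G (busy (Suc n) x) - pre_value A G (busy n x))"
  have w_int: "integrable path_space (?w n)" for n
    unfolding right_diff_distrib
    by (intro Bochner_Integration.integrable_diff integrable_fun_of_busy)
  have telescope: "\<bar>\<Sum>n<N. \<integral>x. ?w n x \<partial>path_space\<bar> \<le> 2 * W" for N
  proof -
    interpret path: prob_space path_space
      by (rule prob_space_path)
    have "\<bar>\<Sum>n<N. ?w n x\<bar> \<le> 2 * W" for x
    proof -
      have "arr n x \<le> T" if "arr (Suc n) x \<le> T" for n
        using that arr_mono[of n "Suc n" x] by simp
      from sum_gated_telescope[where p = "\<lambda>n. arr n x \<le> T" and N = N and w = "\<lambda>n. pre_value A G (busy n x)", OF this]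
      obtain m where "(\<Sum>n<N. ?w n x) = pre_value A G (busy m x) - pre_value A G (busy 0 x)"
        by auto
      moreover have "\<bar>pre_value A G (busy k x)\<bar> \<le> W" for k
        unfolding W_def using busy_le[of k x] by (intro abs_fun_of_busy_le[where h = "pre_value A G"]) simp
      from this[of m] this[of 0] have "\<bar>pre_value A G (busy m x) - pre_value A G (busy 0 x)\<bar> \<le> 2 * W"
        by linarith
      ultimately show ?thesis
        by simp
    qed
    then have "\<bar>\<integral>x. (\<Sum>n<N. ?w n x) \<partial>path_space\<bar> \<le> 2 * W"
      by (intro order_trans[OF integral_abs_bound] path.integral_le_const integrable_abs
          Bochner_Integration.integrable_sum w_int) auto
    then show ?thesis
      by (subst (asm) Bochner_Integration.integral_sum) (auto intro: w_int)
  qed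
  have drift_int: "integrable path_space (\<lambda>x. of_bool (arr n x \<le> T) * drift A G (busy n x) (rate n x))" for n
  proof -
    have "\<bar>drift A G k l\<bar> \<le> b * (b / a + c + \<bar>post_value A G (Suc k) - post_value A G k\<bar>) +
        \<bar>\<mu> * (A * real k + 2 * G * real (k choose 2))\<bar>" if "0 \<le> l" "l \<le> b" for k l
    proof -
      have "\<bar>price l - c + (post_value A G (Suc k) - post_value A G k)\<bar> \<le>
          b / a + c + \<bar>post_value A G (Suc k) - post_value A G k\<bar>"
        using price_minus_cost_bound[OF that] by linarith
      then have "\<bar>of_bool (k < C) * l * (price l - c + (post_value A G (Suc k) - post_value A G k))\<bar> \<le>
          b * (b / a + c + \<bar>post_value A G (Suc k) - post_value A G k\<bar>)"
        unfolding abs_mult using that max_rate_pos by (intro mult_mono) auto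
      then show ?thesis
        unfolding drift_def by linarith
    qed
    note bound = this[OF rate_nonneg rate_le]
    let ?B = "\<lambda>k. b * (b / a + c + \<bar>post_value A G (Suc k) - post_value A G k\<bar>) +
        \<bar>\<mu> * (A * real k + 2 * G * real (k choose 2))\<bar>"
    show ?thesis
    proof (rule integrable_bounded[where B = "\<Sum>j\<le>Suc C. \<bar>?B j\<bar>"])
      show "\<bar>of_bool (arr n x \<le> T) * drift A G (busy n x) (rate n x)\<bar> \<le> (\<Sum>j\<le>Suc C. \<bar>?B j\<bar>)" for x
        using bound[of "busy n x" n x] abs_fun_of_busy_le[of "busy n x" ?B] busy_le[of n x]
        by (auto simp: abs_mult intro: sum_nonneg)
    qed measurable
  qed
  have poisson_sum: "(\<Sum>n<N. \<integral>x. reward T n x \<partial>path_space) =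
      (\<Sum>n<N. (\<integral>x. of_bool (arr n x \<le> T) * drift A G (busy n x) (rate n x) \<partial>path_space) / b) -
      (\<Sum>n<N. \<integral>x. ?w n x \<partial>path_space)" for N
    by (simp only: poisson_equation[of T _ A G] sum_subtractf)
  show "(\<Sum>n. \<integral>x. reward T n x \<partial>path_space) \<le> g * T + 2 * W"
    if le: "\<And>k l. k \<le> C \<Longrightarrow> 0 \<le> l \<Longrightarrow> l \<le> b \<Longrightarrow> drift A G k l \<le> g"
  proof (rule LIMSEQ_le[OF lim plim])
    have "(\<integral>x. of_bool (arr n x \<le> T) * drift A G (busy n x) (rate n x) \<partial>path_space) \<le>
        (\<integral>x. g * of_bool (arr n x \<le> T) \<partial>path_space)" for n
      by (intro integral_mono drift_int integrable_mult_right integrable_arr_le)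
         (auto intro: le busy_le rate_nonneg rate_le)
    then have "(\<Sum>n<N. (\<integral>x. of_bool (arr n x \<le> T) * drift A G (busy n x) (rate n x) \<partial>path_space) / b) \<le>
        (\<Sum>n<N. g * ?p n / b)" for N
      using max_rate_pos by (intro sum_mono divide_right_mono) (auto simp: integrable_arr_le)
    also have "(\<Sum>n<N. g * ?p n / b) = g / b * (\<Sum>n<N. ?p n)" for N
      by (simp add: sum_distrib_left)
    finally have "(\<Sum>n<N. \<integral>x. reward T n x \<partial>path_space) \<le> g / b * (\<Sum>n<N. ?p n) + 2 * W" for N
      using telescope[of N] unfolding poisson_sum by (simp add: abs_le_iff) (smt (verit))
    then show "\<exists>N. \<forall>n\<ge>N. (\<Sum>n<n. \<integral>x. reward T n x \<partial>path_space) \<le> g / b * (\<Sum>n<n. ?p n) + 2 * W"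
      by blast
  qed
  show "g * T - 2 * W \<le> (\<Sum>n. \<integral>x. reward T n x \<partial>path_space)"
    if ge: "\<And>n x. g \<le> drift A G (busy n x) (rate n x)"
  proof (rule LIMSEQ_le[OF _ lim])
    show "(\<lambda>N. g / b * (\<Sum>n<N. ?p n) - 2 * W) \<longlonglongrightarrow> g * T - 2 * W"
      using plim[of "- (2 * W)"] by simp
    have "(\<integral>x. g * of_bool (arr n x \<le> T) \<partial>path_space) \<le>
        (\<integral>x. of_bool (arr n x \<le> T) * drift A G (busy n x) (rate n x) \<partial>path_space)" for n
      by (intro integral_mono drift_int integrable_mult_right integrable_arr_le) (auto intro: ge)
    then have "(\<Sum>n<N. g * ?p n / b) \<le>
        (\<Sum>n<N. (\<integral>x. of_bool (arr n x \<le> T) * drift A G (busy n x) (rate n x) \<partial>path_space) / b)" for N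
      using max_rate_pos by (intro sum_mono divide_right_mono) (auto simp: integrable_arr_le)
    moreover have "(\<Sum>n<N. g * ?p n / b) = g / b * (\<Sum>n<N. ?p n)" for N
      by (simp add: sum_distrib_left)
    ultimately have "g / b * (\<Sum>n<N. ?p n) - 2 * W \<le> (\<Sum>n<N. \<integral>x. reward T n x \<partial>path_space)" for N
      using telescope[of N] unfolding poisson_sum by (simp add: abs_le_iff) (smt (verit))
    then show "\<exists>N. \<forall>n\<ge>N. g / b * (\<Sum>n<n. ?p n) - 2 * W \<le> (\<Sum>n<n. \<integral>x. reward T n x \<partial>path_space)"
      by blast
  qed
qed

end

subsection \<open>Predictable policies as functions of the observations\<close>

text \<open>The Doob-Dynkin factorization, relative to a set \<open>X\<close>. With values in
  \<open>ennreal\<close> the induction over indicators, sums and increasing limits always has a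
  supremum to factor through.\<close>

lemma measurable_vimage_algebra_factor:
  fixes f :: "'a \<Rightarrow> ennreal"
  assumes f: "f \<in> borel_measurable (vimage_algebra X Y N)" and Y: "Y \<in> X \<rightarrow> space N"
  shows "\<exists>\<phi>\<in>borel_measurable N. \<forall>x\<in>X. f x = \<phi> (Y x)"
  using f
proof (induction rule: borel_measurable_induct)
  case (cong f g)
  then show ?case by simp
next
  case (set A)
  then obtain B where "B \<in> sets N" "A = Y -` B \<inter> X"
    using Y by (auto simp: sets_vimage_algebra2)
  then show ?case
    by (intro bexI[of _ "indicator B"]) (auto simp: indicator_def)
next
  case (mult u c)
  then obtain \<phi> where "\<phi> \<in> borel_measurable N" "\<forall>x\<in>X. u x = \<phi> (Y x)"
    by blast
  then show ?case
    by (intro bexI[of _ "\<lambda>y. c * \<phi> y"]) auto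
next
  case (add u v)
  then obtain \<phi> \<psi> where "\<phi> \<in> borel_measurable N" "\<forall>x\<in>X. u x = \<phi> (Y x)"
    "\<psi> \<in> borel_measurable N" "\<forall>x\<in>X. v x = \<psi> (Y x)"
    by blast
  then show ?case
    by (intro bexI[of _ "\<lambda>y. \<psi> y + \<phi> y"]) auto
next
  case (seq U)
  then have "\<forall>i. \<exists>\<phi>\<in>borel_measurable N. \<forall>x\<in>X. U i x = \<phi> (Y x)"
    by simp
  then obtain \<phi> where "\<And>i. \<phi> i \<in> borel_measurable N" "\<And>i. \<forall>x\<in>X. U i x = \<phi> i (Y x)"
    by metis
  then show ?case
    by (intro bexI[of _ "\<lambda>y. SUP i. \<phi> i y"]) (auto simp: image_image)
qed

text \<open>A sum over an infinite set is 0 by convention, so unbounded index sets are split off; on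
  the rest the sum is a series with finitely many nonzero terms.\<close>

lemma measurable_sum_random_set:
  fixes f :: "nat \<Rightarrow> 'a \<Rightarrow> real"
  assumes [measurable]: "\<And>n. Measurable.pred N (P n)" "\<And>n. f n \<in> borel_measurable N"
  shows "(\<lambda>x. \<Sum>n | P n x. f n x) \<in> borel_measurable N"
proof -
  have "(\<Sum>n | P n x. f n x) =
      (if \<exists>m. \<forall>n. P n x \<longrightarrow> n < m then \<Sum>n. of_bool (P n x) * f n x else 0)" for x
  proof (cases "\<exists>m. \<forall>n. P n x \<longrightarrow> n < m")
    case True
    then have "finite {n. P n x}"
      by (auto simp: finite_nat_set_iff_bounded)
    then have "(\<Sum>n. of_bool (P n x) * f n x) = (\<Sum>n | P n x. of_bool (P n x) * f n x)"
      by (intro suminf_finite) auto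
    with True show ?thesis
      by simp
  next
    case False
    then have "infinite {n. P n x}"
      by (auto simp: finite_nat_set_iff_bounded)
    then show ?thesis
      unfolding if_not_P[OF False] by simp
  qed
  then show ?thesis
    by simp
qed

context reusable_resource
begin

lemma sources_measurable[measurable]:
  "gap n \<in> borel_measurable M" "val n \<in> borel_measurable M" "service n \<in> borel_measurable M" "exo \<in> borel_measurable M"
  using src_measurable[of "Gap n"] src_measurable[of "Valuation n"] src_measurable[of "Service n"]
    src_measurable[of Exogenous] by simp_all

lemma arr_observed: "k \<le> n \<Longrightarrow> arr k (observed n x) = arr k x"
  unfolding arr_def by (intro sum.cong) (auto simp: observed_def)

lemma arr_strict_mono: "regular x \<Longrightarrow> m < n \<Longrightarrow> arr m x < arr n x"
  unfolding arr_def by (intro sum_strict_mono2[where b = n]) (auto simp: regular_def less_imp_neq[symmetric])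

lemma sets_history:
  "sets (history t) = sigma_sets (space M)
     ({exo -` B \<inter> space M | B. B \<in> sets borel}
      \<union> {{\<omega> \<in> space M. arrival n \<omega> \<le> s \<and> val n \<omega> \<le> v} | n s v. s \<le> t}
      \<union> {{\<omega> \<in> space M. arrival n \<omega> + service n \<omega> \<le> s} | n s. s \<le> t})"
  unfolding history_def by (rule sets_measure_of) auto

lemma space_history[simp]: "space (history t) = space M"
  unfolding history_def by (rule space_measure_of) auto

lemma history_subset: "sets (history t) \<subseteq> sets M"
  unfolding sets_history by (rule sets.sigma_sets_subset) auto

lemma measurable_predictableI:
  assumes "space N \<subseteq> space M"
    and "\<And>A. A \<in> sets (history 0) \<Longrightarrow> {\<omega> \<in> space N. X \<omega> \<le> 0 \<and> \<omega> \<in> A} \<in> sets N"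
    and "\<And>s t A. 0 \<le> s \<Longrightarrow> s < t \<Longrightarrow> A \<in> sets (history s) \<Longrightarrow> {\<omega> \<in> space N. s < X \<omega> \<and> X \<omega> \<le> t \<and> \<omega> \<in> A} \<in> sets N"
  shows "(\<lambda>\<omega>. (X \<omega>, \<omega>)) \<in> measurable N predictable"
  unfolding predictable_def
proof (rule measurable_measure_of)
  show "{{..0} \<times> A |A. A \<in> sets (history 0)} \<union> {{s<..t} \<times> A |s t A. 0 \<le> s \<and> s < t \<and> A \<in> sets (history s)}
      \<subseteq> Pow (UNIV \<times> space M)"
    using history_subset sets.sets_into_space by fastforce
  show "(\<lambda>\<omega>. (X \<omega>, \<omega>)) \<in> space N \<rightarrow> UNIV \<times> space M"
    using assms(1) by auto
  fix E assume "E \<in> {{..0} \<times> A |A. A \<in> sets (history 0)} \<union>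
      {{s<..t} \<times> A |s t A. 0 \<le> s \<and> s < t \<and> A \<in> sets (history s)}"
  then consider A where "E = {..0} \<times> A" "A \<in> sets (history 0)"
    | s t A where "E = {s<..t} \<times> A" "0 \<le> s" "s < t" "A \<in> sets (history s)"
    by blast
  then show "(\<lambda>\<omega>. (X \<omega>, \<omega>)) -` E \<inter> space N \<in> sets N"
  proof cases
    case (1 A)
    have "(\<lambda>\<omega>. (X \<omega>, \<omega>)) -` E \<inter> space N = {\<omega> \<in> space N. X \<omega> \<le> 0 \<and> \<omega> \<in> A}"
      unfolding 1 by auto
    then show ?thesis
      using assms(2) 1 by simp
  next
    case (2 s t A)
    have "(\<lambda>\<omega>. (X \<omega>, \<omega>)) -` E \<inter> space N = {\<omega> \<in> space N. s < X \<omega> \<and> X \<omega> \<le> t \<and> \<omega> \<in> A}"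
      unfolding 2 by auto
    then show ?thesis
      using assms(3) 2 by simp
  qed
qed

lemma policy_measurable:
  assumes "policy \<sigma>" and [measurable]: "X \<in> borel_measurable M"
  shows "(\<lambda>\<omega>. \<sigma> (X \<omega>) \<omega>) \<in> borel_measurable M"
proof -
  have "(\<lambda>\<omega>. (X \<omega>, \<omega>)) \<in> measurable M predictable"
  proof (rule measurable_predictableI)
    fix A assume "A \<in> sets (history 0)"
    then have [measurable]: "A \<in> sets M"
      using history_subset by auto
    show "{\<omega> \<in> space M. X \<omega> \<le> 0 \<and> \<omega> \<in> A} \<in> sets M"
      by measurable
  next
    fix s t A assume "A \<in> sets (history s)"
    then have [measurable]: "A \<in> sets M"
      using history_subset by auto
    show "{\<omega> \<in> space M. s < X \<omega> \<and> X \<omega> \<le> t \<and> \<omega> \<in> A} \<in> sets M"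
      by measurable
  qed simp
  from measurable_compose[OF this, of "\<lambda>(t, \<omega>). \<sigma> t \<omega>" borel] assms(1) show ?thesis
    by (simp add: policy_def)
qed

text \<open>The sigma-algebra generated by \<open>observed n\<close>, on the regular outcomes only,
  because only there \<open>arr\<close> is known to agree with \<open>arrival\<close>.\<close>

definition observation :: "nat \<Rightarrow> 'w measure" where
  "observation n =
     vimage_algebra {\<omega> \<in> space M. regular (outcome \<omega>)} (\<lambda>\<omega>. observed n (outcome \<omega>)) path_space"

lemma space_observation: "space (observation n) = {\<omega> \<in> space M. regular (outcome \<omega>)}"
  by (simp add: observation_def)

lemma observationI:
  assumes "Measurable.pred path_space P"
    and "\<And>\<omega>. \<omega> \<in> space M \<Longrightarrow> regular (outcome \<omega>) \<Longrightarrow> Q \<omega> = P (observed n (outcome \<omega>))"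
  shows "{\<omega> \<in> space (observation n). Q \<omega>} \<in> sets (observation n)"
proof -
  have "{\<omega> \<in> space (observation n). Q \<omega>} =
      (\<lambda>\<omega>. observed n (outcome \<omega>)) -` {y \<in> space path_space. P y} \<inter> {\<omega> \<in> space M. regular (outcome \<omega>)}"
    using assms(2) by (auto simp: space_observation)
  then show ?thesis
    using assms(1) unfolding observation_def by (simp only:) (intro in_vimage_algebra, simp add: pred_def)
qed

text \<open>The strict inequality \<open>s < arrival n \<omega>\<close> makes this work: by time
  \<open>s\<close> customer \<open>n\<close> and all later ones have revealed nothing, and a
  completion of an earlier customer by time \<open>s\<close> is not affected by censoring at arrival
  \<open>n\<close>. This is what predictability provides; with a non-strict inequality the valuation
  of customer \<open>n\<close> could be visible.\<close>

lemma history_observation: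
  assumes "A \<in> sets (history s)"
  shows "{\<omega> \<in> space (observation n). s < arrival n \<omega> \<and> \<omega> \<in> A} \<in> sets (observation n)"
  using assms unfolding sets_history
proof (induction rule: sigma_sets.induct)
  case (Basic A)
  then consider B where "A = exo -` B \<inter> space M" "B \<in> sets borel"
    | m s' v where "A = {\<omega> \<in> space M. arrival m \<omega> \<le> s' \<and> val m \<omega> \<le> v}" "s' \<le> s"
    | m s' where "A = {\<omega> \<in> space M. arrival m \<omega> + service m \<omega> \<le> s'}" "s' \<le> s"
    by (elim UnE CollectE exE conjE) (simp_all only:)
  then show ?case
  proof cases
    case (1 B)
    note [measurable] = 1(2)
    show ?thesis
      by (rule observationI[where P = "\<lambda>y. s < arr n y \<and> y Exogenous \<in> B"])
         (auto simp: 1 arr_observed arr_outcome observed_def outcome_def)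
  next
    case (2 m s' v)
    show ?thesis
    proof (cases "m < n")
      case True
      show ?thesis
        by (rule observationI[where P = "\<lambda>y. s < arr n y \<and> arr m y \<le> s' \<and> y (Valuation m) \<le> v"])
           (use True in \<open>auto simp: 2 arr_observed arr_outcome observed_def outcome_def\<close>)
    next
      case False
      then have "\<not> (s < arrival n \<omega> \<and> \<omega> \<in> A)" if "regular (outcome \<omega>)" for \<omega>
        using arr_mono[of n m "outcome \<omega>"] that 2 by (auto simp: arr_outcome)
      then have "{\<omega> \<in> space (observation n). s < arrival n \<omega> \<and> \<omega> \<in> A} = {}"
        by (auto simp: space_observation)
      then show ?thesis
        by (simp only: sets.empty_sets)
    qed
  next
    case (3 m s')
    show ?thesis
    proof (cases "m < n")
      case True
      show ?thesis
        by (rule observationI[where P = "\<lambda>y. s < arr n y \<and> arr m y + y (Service m) \<le> s'"])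
           (use True 3(2) in \<open>auto simp: 3(1) arr_observed arr_outcome observed_def outcome_def min_def\<close>)
    next
      case False
      have "\<not> (s < arrival n \<omega> \<and> \<omega> \<in> A)" if "regular (outcome \<omega>)" for \<omega>
      proof -
        have "0 < service m \<omega>"
          using that by (auto simp: regular_def outcome_def)
        then show ?thesis
          using arr_mono[of n m "outcome \<omega>"] that 3 False by (auto simp: arr_outcome)
      qed
      then have "{\<omega> \<in> space (observation n). s < arrival n \<omega> \<and> \<omega> \<in> A} = {}"
        by (auto simp: space_observation)
      then show ?thesis
        by (simp only: sets.empty_sets)
    qed
  qed
next
  case Empty
  show ?case by simp
next
  case (Compl A)
  have "{\<omega> \<in> space (observation n). s < arrival n \<omega>} \<in> sets (observation n)"
    by (rule observationI[where P = "\<lambda>y. s < arr n y"]) (auto simp: arr_observed arr_outcome)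
  from sets.Diff[OF this Compl.IH]
  show ?case
    by (rule back_subst[of "\<lambda>E. E \<in> sets (observation n)"]) (auto simp: space_observation)
next
  case (Union A)
  have "{\<omega> \<in> space (observation n). s < arrival n \<omega> \<and> \<omega> \<in> (\<Union>i. A i)} =
      (\<Union>i. {\<omega> \<in> space (observation n). s < arrival n \<omega> \<and> \<omega> \<in> A i})"
    by auto
  also have "\<dots> \<in> sets (observation n)"
    using Union.IH by (intro sets.countable_UN) auto
  finally show ?case .
qed

text \<open>Along the graph of \<open>arrival n\<close>, predictable sets pull back to events of
  \<open>observation n\<close>, so the rate met by customer \<open>n\<close> factors through what
  has been observed.\<close>

lemma policy_rate_control:
  assumes "policy \<sigma>"
  obtains rate where "rate_control M C a b \<mu> c gap val service exo rate"
    and "\<And>n \<omega>. \<omega> \<in> space M \<Longrightarrow> regular (outcome \<omega>) \<Longrightarrow> \<sigma> (arrival n \<omega>) \<omega> = rate n (outcome \<omega>)"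
proof -
  have "\<exists>\<phi>\<in>borel_measurable path_space. \<forall>\<omega>\<in>{\<omega> \<in> space M. regular (outcome \<omega>)}.
      ennreal (\<sigma> (arrival n \<omega>) \<omega>) = \<phi> (observed n (outcome \<omega>))" for n
  proof (rule measurable_vimage_algebra_factor)
    have "(\<lambda>\<omega>. (arrival n \<omega>, \<omega>)) \<in> measurable (observation n) predictable"
    proof (rule measurable_predictableI)
      fix A
      \<comment> \<open>Arrival times are positive, so the generators for times up to 0 have empty
        preimage.\<close>
      have "arrival n \<omega> > 0" if "\<omega> \<in> space (observation n)" for \<omega>
        using that unfolding arrival_def
        by (intro sum_pos) (auto simp: space_observation regular_def outcome_def)
      then have "{\<omega> \<in> space (observation n). arrival n \<omega> \<le> 0 \<and> \<omega> \<in> A} = {}"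
        by force
      then show "{\<omega> \<in> space (observation n). arrival n \<omega> \<le> 0 \<and> \<omega> \<in> A} \<in> sets (observation n)"
        by (simp only: sets.empty_sets)
    next
      fix s t :: real and A assume "A \<in> sets (history s)"
      moreover have "{\<omega> \<in> space (observation n). arrival n \<omega> \<le> t} \<in> sets (observation n)"
        by (rule observationI[where P = "\<lambda>y. arr n y \<le> t"]) (auto simp: arr_observed arr_outcome)
      ultimately have "{\<omega> \<in> space (observation n). s < arrival n \<omega> \<and> \<omega> \<in> A} \<inter>
          {\<omega> \<in> space (observation n). arrival n \<omega> \<le> t} \<in> sets (observation n)"
        by (intro sets.Int history_observation)
      then show "{\<omega> \<in> space (observation n). s < arrival n \<omega> \<and> arrival n \<omega> \<le> t \<and> \<omega> \<in> A} \<in> sets (observation n)"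
        by (rule back_subst[of "\<lambda>E. E \<in> sets (observation n)"]) auto
    qed (auto simp: space_observation)
    from measurable_compose[OF this, of "\<lambda>(t, \<omega>). \<sigma> t \<omega>" borel] assms
    have "(\<lambda>\<omega>. \<sigma> (arrival n \<omega>) \<omega>) \<in> borel_measurable (observation n)"
      by (simp add: policy_def)
    then show "(\<lambda>\<omega>. ennreal (\<sigma> (arrival n \<omega>) \<omega>)) \<in> borel_measurable
        (vimage_algebra {\<omega> \<in> space M. regular (outcome \<omega>)} (\<lambda>\<omega>. observed n (outcome \<omega>)) path_space)"
      unfolding observation_def by measurable
  qed simp
  then obtain \<phi> where \<phi>[measurable]: "\<And>n. \<phi> n \<in> borel_measurable path_space"
    and \<sigma>: "\<And>n \<omega>. \<omega> \<in> space M \<Longrightarrow> regular (outcome \<omega>) \<Longrightarrow>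
      ennreal (\<sigma> (arrival n \<omega>) \<omega>) = \<phi> n (observed n (outcome \<omega>))"
    by (simp add: Bex_def) metis
  \<comment> \<open>Composition with \<open>observed n\<close> makes the rate a function of the
    observation on every path. Clipping at \<open>b\<close> keeps it in range off the regular
    outcomes too, where the factorization says nothing.\<close>
  define rate where "rate n x = min b (enn2real (\<phi> n (observed n x)))" for n x
  show ?thesis
  proof
    show "rate_control M C a b \<mu> c gap val service exo rate"
    proof
      show "rate n \<in> borel_measurable path_space" for n
        unfolding rate_def[abs_def] by measurable
    qed (use max_rate_pos in \<open>auto simp: rate_def\<close>)
    fix n \<omega> assume "\<omega> \<in> space M" "regular (outcome \<omega>)"
    moreover from this have "0 \<le> \<sigma> (arrival n \<omega>) \<omega>" "\<sigma> (arrival n \<omega>) \<omega> \<le> b"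
      using assms by (auto simp: policy_def)
    ultimately show "\<sigma> (arrival n \<omega>) \<omega> = rate n (outcome \<omega>)"
      by (simp add: rate_def \<sigma>[symmetric])
  qed
qed

end

section \<open>Expected profit of a policy through the embedded chain\<close>

context rate_control
begin

context
  fixes \<sigma> :: "real \<Rightarrow> 'a \<Rightarrow> real"
  assumes policy: "policy \<sigma>"
    and rate: "\<And>n \<omega>. \<omega> \<in> space M \<Longrightarrow> regular (outcome \<omega>) \<Longrightarrow> \<sigma> (arrival n \<omega>) \<omega> = rate n (outcome \<omega>)"
begin

lemma effective_iff:
  "\<omega> \<in> space M \<Longrightarrow> regular (outcome \<omega>) \<Longrightarrow> effective \<sigma> n \<omega> \<longleftrightarrow> accepts n (outcome \<omega>)"
  by (simp add: effective_def accepts_def rate) (simp add: outcome_def)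

text \<open>Only customers with index below \<open>n\<close> can have arrived before arrival
  \<open>n\<close>, so \<open>D\<close> matters only there. This covers both the set built up step
  by step in \<open>served_upto\<close> and its union over all steps.\<close>

lemma occupied_before_eq:
  assumes "\<omega> \<in> space M" "regular (outcome \<omega>)" "D \<inter> {..<n} = served n (outcome \<omega>)"
  shows "occupied_before D (arrival n \<omega>) \<omega> = busy n (outcome \<omega>)"
proof -
  have "m \<in> D \<and> arrival m \<omega> < arrival n \<omega> \<longleftrightarrow> m \<in> served n (outcome \<omega>)" for m
  proof -
    have "arr m (outcome \<omega>) < arr n (outcome \<omega>) \<longleftrightarrow> m < n"
      using arr_strict_mono[OF assms(2), of m n] arr_mono[of n m "outcome \<omega>"] by linarith
    then show ?thesis
      unfolding assms(3)[symmetric] by (simp add: arr_outcome[OF assms(2)])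
  qed
  then have "{m \<in> D. arrival m \<omega> < arrival n \<omega> \<and> arrival n \<omega> \<le> arrival m \<omega> + service m \<omega>} =
      present (served n (outcome \<omega>)) (arr n (outcome \<omega>)) (outcome \<omega>)"
    unfolding present_def arr_outcome[OF assms(2)] by (simp only: outcome_def src.simps) blast
  then show ?thesis
    by (simp add: occupied_before_def busy_def)
qed

lemma served_upto_eq:
  assumes "\<omega> \<in> space M" "regular (outcome \<omega>)"
  shows "served_upto \<sigma> n \<omega> = served n (outcome \<omega>)"
proof (induction n)
  case (Suc n)
  have "occupied_before (served_upto \<sigma> n \<omega>) (arrival n \<omega>) \<omega> = busy n (outcome \<omega>)"
    by (rule occupied_before_eq[OF assms]) (auto simp: Suc served_iff)
  then show ?case
    using Suc by (simp add: served_Suc admits_def effective_iff assms)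
qed simp

lemma available_before_eq:
  assumes "\<omega> \<in> space M" "regular (outcome \<omega>)"
  shows "available_before \<sigma> (arrival n \<omega>) \<omega> = C - busy n (outcome \<omega>)"
proof -
  have "occupied_before (\<Union>n. served_upto \<sigma> n \<omega>) (arrival n \<omega>) \<omega> = busy n (outcome \<omega>)"
    by (rule occupied_before_eq[OF assms]) (auto simp: served_upto_eq[OF assms] served_iff)
  then show ?thesis
    by (simp add: available_before_def)
qed

text \<open>With infinitely many arrivals the sum in \<open>profit\<close> could be 0 by convention
  while the series is not; finiteness rules this out.\<close>

lemma profit_eq_suminf:
  assumes "\<omega> \<in> space M" "regular (outcome \<omega>)" "finite {n. arr n (outcome \<omega>) \<le> T}"
  shows "profit \<sigma> T \<omega> = (\<Sum>n. reward T n (outcome \<omega>))"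
proof -
  have "profit \<sigma> T \<omega> = (\<Sum>n | arr n (outcome \<omega>) \<le> T \<and> accepts n (outcome \<omega>). reward T n (outcome \<omega>))"
    unfolding profit_def
    by (intro sum.cong)
       (auto simp: effective_iff[OF assms(1,2)] available_before_eq[OF assms(1,2)] arr_outcome[OF assms(2)]
          reward_def admits_def rate[OF assms(1,2)])
  also have "\<dots> = (\<Sum>n. reward T n (outcome \<omega>))"
    by (rule suminf_finite[symmetric]) (use assms(3) in \<open>auto simp: reward_def admits_def\<close>)
  finally show ?thesis .
qed

lemma AE_finite_arrivals: "AE \<omega> in M. finite {n. arr n (outcome \<omega>) \<le> T}"
proof (cases "0 \<le> T")
  case True
  interpret path: prob_space path_space
    by (rule prob_space_path)
  have sets: "{x \<in> space path_space. arr n x \<le> T} \<in> sets path_space" for n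
    by measurable
  \<comment> \<open>The probabilities add up to \<open>b * T\<close>, so Borel-Cantelli
    applies.\<close>
  have "summable (\<lambda>n. measure path_space {x \<in> space path_space. arr n x \<le> T})"
  proof (rule back_subst[of summable, OF sums_summable[OF sums_prob_arr[OF True]]], intro ext)
    show "(\<integral>x. of_bool (arr n x \<le> T) \<partial>path_space) = measure path_space {x \<in> space path_space. arr n x \<le> T}" for n
      by (rule integral_of_bool[OF sets])
  qed
  then have "AE x in path_space. eventually (\<lambda>n. x \<in> space path_space - {x \<in> space path_space. arr n x \<le> T}) sequentially"
    by (intro borel_cantelli_AE1 sets) (auto simp: path.emeasure_eq_measure)
  then have "AE x in path_space. finite {n. arr n x \<le> T}"
    by eventually_elim (auto simp: eventually_sequentially finite_nat_set_iff_bounded intro: not_le_imp_less)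
  then show ?thesis
    by (rule AE_outcome)
next
  case False
  have "0 \<le> arr n x" for n x
    by (simp add: arr_def sum_nonneg)
  with False have "{n. arr n (outcome \<omega>) \<le> T} = {}" for \<omega>
    by (auto simp: not_le) (meson less_le_trans not_le)
  then show ?thesis
    by simp
qed

lemma pred_effective[measurable]: "Measurable.pred M (effective \<sigma> n)"
proof -
  have [measurable]: "(\<lambda>\<omega>. \<sigma> (arrival n \<omega>) \<omega>) \<in> borel_measurable M"
    by (rule policy_measurable[OF policy]) measurable
  show ?thesis
    unfolding effective_def[abs_def] price_def by measurable
qed

lemma occupied_before_measurable:
  assumes [measurable]: "\<And>m. Measurable.pred M (\<lambda>\<omega>. m \<in> D \<omega>)" "t \<in> borel_measurable M"
  shows "(\<lambda>\<omega>. occupied_before (D \<omega>) (t \<omega>) \<omega>) \<in> measurable M (count_space UNIV)"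
proof (rule measurable_nat_ofI)
  show "(\<lambda>\<omega>. real (occupied_before (D \<omega>) (t \<omega>) \<omega>)) \<in> borel_measurable M"
    unfolding occupied_before_def card_eq_sum of_nat_sum of_nat_1
    by (rule measurable_sum_random_set) measurable
qed

lemma pred_served_upto[measurable]: "Measurable.pred M (\<lambda>\<omega>. m \<in> served_upto \<sigma> n \<omega>)"
proof (induction n arbitrary: m)
  case (Suc n)
  note [measurable] = Suc occupied_before_measurable[OF Suc arrival_measurable]
  have "(m \<in> served_upto \<sigma> (Suc n) \<omega>) = (m \<in> served_upto \<sigma> n \<omega> \<or>
      m = n \<and> effective \<sigma> n \<omega> \<and> occupied_before (served_upto \<sigma> n \<omega>) (arrival n \<omega>) \<omega> < C)" for \<omega>
    by auto
  then show ?case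
    by (simp only:) measurable
qed simp

text \<open>The space \<open>M\<close> need not be complete, so almost sure equality with a
  measurable series does not give measurability; it is derived from the definition instead.\<close>

lemma profit_measurable: "profit \<sigma> T \<in> borel_measurable M"
proof -
  have [measurable]: "(\<lambda>\<omega>. \<sigma> (arrival n \<omega>) \<omega>) \<in> borel_measurable M" for n
    by (rule policy_measurable[OF policy]) measurable
  have [measurable]: "(\<lambda>\<omega>. occupied_before (\<Union>n. served_upto \<sigma> n \<omega>) (arrival m \<omega>) \<omega>) \<in> measurable M (count_space UNIV)" for m
    by (rule occupied_before_measurable) (auto simp: UN_iff)
  show ?thesis
    unfolding profit_def[abs_def] available_before_def price_def
    by (rule measurable_sum_random_set) measurable
qed

lemma expectation_profit:
  assumes "0 \<le> T"
  shows "expectation (profit \<sigma> T) = (\<Sum>n. \<integral>x. reward T n x \<partial>path_space)"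
proof -
  have fin: "AE x in M. finite {n. arr n (outcome x) \<le> T}"
    by (rule AE_finite_arrivals)
  have "expectation (profit \<sigma> T) = (\<integral>\<omega>. (\<Sum>n. reward T n (outcome \<omega>)) \<partial>M)"
  proof (rule integral_cong_AE)
    show "AE \<omega> in M. profit \<sigma> T \<omega> = (\<Sum>n. reward T n (outcome \<omega>))"
      using fin AE_regular_outcome AE_space by eventually_elim (rule profit_eq_suminf)
  qed (auto intro: profit_measurable)
  also have "\<dots> = (\<Sum>n. \<integral>\<omega>. reward T n (outcome \<omega>) \<partial>M)"
  proof (rule integral_suminf)
    show "integrable M (\<lambda>\<omega>. reward T n (outcome \<omega>))" for n
      using integrable_reward[of T n] by (subst (asm) distr_outcome[symmetric]) (simp add: integrable_distr_eq)
    show "AE \<omega> in M. summable (\<lambda>n. norm (reward T n (outcome \<omega>)))"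
      using fin by eventually_elim (rule summable_finite, auto simp: reward_def)
    show "summable (\<lambda>n. \<integral>\<omega>. norm (reward T n (outcome \<omega>)) \<partial>M)"
    proof (rule back_subst[of summable, OF reward_sum_bounds(3)[OF assms]], intro ext)
      show "(\<integral>x. \<bar>reward T n x\<bar> \<partial>path_space) = (\<integral>\<omega>. norm (reward T n (outcome \<omega>)) \<partial>M)" for n
        using integral_outcome[of "\<lambda>x. \<bar>reward T n x\<bar>"] by simp
    qed
  qed
  also have "\<dots> = (\<Sum>n. \<integral>x. reward T n x \<partial>path_space)"
    by (simp add: integral_outcome)
  finally show ?thesis .
qed

lemma profit_rate_le:
  assumes "\<And>k l. k \<le> C \<Longrightarrow> 0 \<le> l \<Longrightarrow> l \<le> b \<Longrightarrow> drift A G k l \<le> g"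
  shows "profit_rate \<sigma> \<le> ereal g"
proof -
  define W where "W = (\<Sum>j\<le>Suc C. \<bar>pre_value A G j\<bar>)"
  have "((\<lambda>T. g + 2 * W / T) \<longlongrightarrow> g + 0) at_top"
    by (intro tendsto_intros tendsto_divide_0[OF tendsto_const] filterlim_at_top_imp_at_infinity filterlim_ident)
  then have "((\<lambda>T. ereal (g + 2 * W / T)) \<longlongrightarrow> ereal g) at_top"
    by simp
  then have "Liminf at_top (\<lambda>T. ereal (g + 2 * W / T)) = ereal g"
    by (rule lim_imp_Liminf[rotated]) simp
  moreover have "profit_rate \<sigma> \<le> Liminf at_top (\<lambda>T. ereal (g + 2 * W / T))"
    unfolding profit_rate_def
  proof (rule Liminf_mono)
    show "\<forall>\<^sub>F T in at_top. ereal (expectation (profit \<sigma> T) / T) \<le> ereal (g + 2 * W / T)"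
      using eventually_gt_at_top[of 0]
    proof eventually_elim
      case (elim T)
      have "expectation (profit \<sigma> T) \<le> g * T + 2 * W"
        using reward_sum_bounds(1)[OF _ assms, of T] elim unfolding W_def by (simp add: expectation_profit)
      then have "expectation (profit \<sigma> T) / T \<le> (g * T + 2 * W) / T"
        using elim by (intro divide_right_mono) auto
      then show ?case
        using elim by (simp add: add_divide_distrib)
    qed
  qed
  ultimately show ?thesis
    by simp
qed

lemma profit_rate_ge:
  assumes "\<And>n x. g \<le> drift A G (busy n x) (rate n x)"
  shows "ereal g \<le> profit_rate \<sigma>"
proof -
  define W where "W = (\<Sum>j\<le>Suc C. \<bar>pre_value A G j\<bar>)"
  have "((\<lambda>T. g - 2 * W / T) \<longlongrightarrow> g - 0) at_top"
    by (intro tendsto_intros tendsto_divide_0[OF tendsto_const] filterlim_at_top_imp_at_infinity filterlim_ident)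
  then have "((\<lambda>T. ereal (g - 2 * W / T)) \<longlongrightarrow> ereal g) at_top"
    by simp
  then have "Liminf at_top (\<lambda>T. ereal (g - 2 * W / T)) = ereal g"
    by (rule lim_imp_Liminf[rotated]) simp
  moreover have "Liminf at_top (\<lambda>T. ereal (g - 2 * W / T)) \<le> profit_rate \<sigma>"
    unfolding profit_rate_def
  proof (rule Liminf_mono)
    show "\<forall>\<^sub>F T in at_top. ereal (g - 2 * W / T) \<le> ereal (expectation (profit \<sigma> T) / T)"
      using eventually_gt_at_top[of 0]
    proof eventually_elim
      case (elim T)
      have "g * T - 2 * W \<le> expectation (profit \<sigma> T)"
        using reward_sum_bounds(2)[OF _ assms, of T] elim unfolding W_def by (simp add: expectation_profit)
      then have "(g * T - 2 * W) / T \<le> expectation (profit \<sigma> T) / T"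
        using elim by (intro divide_right_mono) auto
      then show ?case
        using elim by (simp add: diff_divide_distrib)
    qed
  qed
  ultimately show ?thesis
    by simp
qed

end

end

subsection \<open>The static rate\<close>

text \<open>For fixed \<open>z\<close> the first equation is quadratic in \<open>s\<close>, with
  root \<open>S z\<close>. The right side of the second is then continuous in \<open>z\<close>,
  equal to 0 at 0 and at least \<open>2 * \<beta>\<close> at \<open>\<beta>\<close>.\<close>

lemma balanced_rates_exist:
  fixes \<beta> :: real
  assumes "0 < \<beta>"
  obtains s z where "0 < s" "0 < z" "z \<le> \<beta>" "s\<^sup>2 / 2 + 2 * s = z\<^sup>2 + 2 * z" "\<beta> = s\<^sup>2 / 2 + 2 * z"
proof -
  define S where "S z = sqrt (4 + 2 * z\<^sup>2 + 4 * z) - 2" for z :: real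
  have cont: "continuous_on {0..\<beta>} (\<lambda>z. (S z)\<^sup>2 / 2 + 2 * z)"
    unfolding S_def by (intro continuous_intros) auto
  have "\<exists>z\<ge>0. z \<le> \<beta> \<and> (S z)\<^sup>2 / 2 + 2 * z = \<beta>"
    using assms by (intro IVT'[OF _ _ _ cont]) (auto simp: S_def intro: add_nonneg_nonneg order_trans)
  then obtain z where z: "0 \<le> z" "z \<le> \<beta>" "(S z)\<^sup>2 / 2 + 2 * z = \<beta>"
    by blast
  have "z \<noteq> 0"
    using z(3) assms by (auto simp: S_def)
  with z(1) have "0 < z"
    by simp
  have "sqrt 4 < sqrt (4 + 2 * z\<^sup>2 + 4 * z)"
    using \<open>0 < z\<close> by (intro real_sqrt_less_mono) (simp add: add_pos_pos)
  then have "0 < S z"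
    by (simp add: S_def)
  have "(S z + 2)\<^sup>2 = 4 + 2 * z\<^sup>2 + 4 * z"
    using \<open>0 < z\<close> by (simp add: S_def)
  then have "(S z)\<^sup>2 / 2 + 2 * S z = z\<^sup>2 + 2 * z"
    by (simp add: power2_eq_square algebra_simps)
  then show ?thesis
    by (rule that[OF \<open>0 < S z\<close> \<open>0 < z\<close> z(2) _ z(3)[symmetric]])
qed

lemma static_rate_ratio:
  fixes s z :: real
  assumes "0 < s" "0 < z" and eq: "s\<^sup>2 / 2 + 2 * s = z\<^sup>2 + 2 * z"
  shows "0.955 * s\<^sup>2 \<le> z * (s\<^sup>2 / 2 + z) * (1 + z) / (1 + z + z\<^sup>2 / 2)"
proof -
  have "0 \<le> (s - z)\<^sup>2"
    by simp
  \<comment> \<open>Bounding \<open>s\<^sup>2\<close> below by its tangent at \<open>z\<close> makes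
    the equation linear in \<open>s\<close> and gives an explicit upper bound without square
    roots.\<close>
  with eq have "2 * (z + 2) * s \<le> z * (3 * z + 4)"
    by (simp add: power2_eq_square algebra_simps)
  then have "(2 * (z + 2) * s)\<^sup>2 \<le> (z * (3 * z + 4))\<^sup>2"
    using assms by (intro power_mono) auto
  then have s2: "4 * (z + 2)\<^sup>2 * s\<^sup>2 \<le> z\<^sup>2 * (3 * z + 4)\<^sup>2"
    unfolding power_mult_distrib by simp
  \<comment> \<open>After the denominator is cleared, \<open>D\<close> is the net coefficient of
    \<open>s\<^sup>2\<close>, namely
    \<open>0.955 * (1 + z + z\<^sup>2 / 2) - z * (1 + z) / 2\<close>. It turns negative for large
    \<open>z\<close>, where the claim is trivial; elsewhere the bound on \<open>s\<close> leaves a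
    polynomial with positive coefficients.\<close>
  define D where "D = 0.955 + 0.455 * z - 0.0225 * z\<^sup>2"
  have "s\<^sup>2 * D \<le> z\<^sup>2 * (1 + z)"
  proof (cases "0 \<le> D")
    case True
    have "4 * (z + 2)\<^sup>2 * (1 + z) - (3 * z + 4)\<^sup>2 * D =
        0.72 + 1.8 * z + 0.845 * z ^ 2 + 0.445 * z ^ 3 + 0.2025 * z ^ 4"
      unfolding D_def by (simp add: power2_eq_square power3_eq_cube power4_eq_xxxx field_simps)
    moreover have "0 \<le> 0.72 + 1.8 * z + 0.845 * z ^ 2 + 0.445 * z ^ 3 + 0.2025 * z ^ 4"
      using assms by (intro add_nonneg_nonneg) auto
    ultimately have "(3 * z + 4)\<^sup>2 * D \<le> 4 * (z + 2)\<^sup>2 * (1 + z)"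
      by linarith
    then have "z\<^sup>2 * ((3 * z + 4)\<^sup>2 * D) \<le> z\<^sup>2 * (4 * (z + 2)\<^sup>2 * (1 + z))"
      by (rule mult_left_mono) simp
    moreover have "4 * (z + 2)\<^sup>2 * s\<^sup>2 * D \<le> z\<^sup>2 * (3 * z + 4)\<^sup>2 * D"
      using s2 True by (rule mult_right_mono)
    ultimately have "4 * (z + 2)\<^sup>2 * (s\<^sup>2 * D) \<le> 4 * (z + 2)\<^sup>2 * (z\<^sup>2 * (1 + z))"
      by (simp add: mult_ac)
    then show ?thesis
      using assms by simp
  next
    case False
    then have "s\<^sup>2 * D \<le> 0"
      by (simp add: mult_nonneg_nonpos)
    also have "0 \<le> z\<^sup>2 * (1 + z)"
      using assms by simp
    finally show ?thesis .
  qed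
  moreover have "0.955 * s\<^sup>2 * (1 + z + z\<^sup>2 / 2) = s\<^sup>2 * D + s\<^sup>2 * (z * (1 + z) / 2)"
    unfolding D_def by (simp add: power2_eq_square field_simps)
  moreover have "z * (s\<^sup>2 / 2 + z) * (1 + z) = z\<^sup>2 * (1 + z) + s\<^sup>2 * (z * (1 + z) / 2)"
    by (simp add: power2_eq_square field_simps)
  ultimately have "0.955 * s\<^sup>2 * (1 + z + z\<^sup>2 / 2) \<le> z * (s\<^sup>2 / 2 + z) * (1 + z)"
    by linarith
  then show ?thesis
    using assms by (simp add: pos_le_divide_eq add_pos_pos)
qed

lemma quadratic_gain_le: "x * (2 * y - x) \<le> (y::real)\<^sup>2"
  using zero_le_power2[of "y - x"] by (simp add: power2_eq_square algebra_simps)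

context reusable_resource
begin

lemma policy_const: "l \<in> {0..b} \<Longrightarrow> policy (\<lambda>_ _. l)"
  by (simp add: policy_def)

lemma static_profit_rate:
  assumes l: "l \<in> {0..b}" and drift: "\<And>k. k \<le> C \<Longrightarrow> drift A G k l = g"
  shows "ereal g \<le> profit_rate (\<lambda>_ _. l)"
proof -
  interpret rate_control M C a b \<mu> c gap val service exo "\<lambda>_ _. l"
    by unfold_locales (use l in auto)
  show ?thesis
    by (rule profit_rate_ge[OF policy_const[OF l], of g A G]) (simp_all add: drift busy_le)
qed

lemma profit_rate_le_drift:
  assumes "policy \<sigma>" and "\<And>k l. k \<le> C \<Longrightarrow> 0 \<le> l \<Longrightarrow> l \<le> b \<Longrightarrow> drift A G k l \<le> g"
  shows "profit_rate \<sigma> \<le> ereal g"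
proof -
  obtain rate where rc: "rate_control M C a b \<mu> c gap val service exo rate"
    and rate: "\<And>n \<omega>. \<omega> \<in> space M \<Longrightarrow> regular (outcome \<omega>) \<Longrightarrow> \<sigma> (arrival n \<omega>) \<omega> = rate n (outcome \<omega>)"
    by (rule policy_rate_control[OF assms(1)]) (rule that)
  interpret rate_control M C a b \<mu> c gap val service exo rate
    by (rule rc)
  show ?thesis
    by (rule profit_rate_le[OF assms(1) rate assms(2)])
qed

text \<open>
  In units where \<open>\<mu> = a = 1\<close>, a profit rate \<open>g\<close> bounds all policies if the opportunity costs \<open>u1\<close>,
  \<open>u2\<close> of the first and the second unit satisfy \<open>(\<beta> - u1)\<^sup>2 / 4 \<le> g\<close>, \<open>(\<beta> - u2)\<^sup>2 / 4 + u1 \<le> g\<close> and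
  \<open>2 * u2 \<le> g\<close>.  Equality in all three, with \<open>g = s\<^sup>2\<close> and \<open>z = (\<beta> - u2) / 2\<close> the rate when one unit is
  busy, is the pair of equations of \<open>balanced_rates_exist\<close>; the static policy uses the rate \<open>z\<close>.
\<close>

lemma static_rate_exists:
  assumes "C = 2"
  obtains l g h A G A' G' where "l \<in> {0..b}" "0 \<le> g" "0.955 * h \<le> g"
    "\<And>k. k \<le> C \<Longrightarrow> drift A G k l = g"
    "\<And>k l. k \<le> C \<Longrightarrow> 0 \<le> l \<Longrightarrow> l \<le> b \<Longrightarrow> drift A' G' k l \<le> h"
proof (cases "b - a * c \<le> 0")
  case True
  \<comment> \<open>The cost is at least the highest price \<open>b / a\<close>, so no sale makes a
    gain: rate 0 and vanishing value functions serve for both bounds.\<close>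
  have "drift 0 0 k l \<le> 0" if "0 \<le> l" for k l
  proof -
    have "price l - c \<le> 0"
      using True that slope_pos by (simp add: price_def field_simps)
    then show ?thesis
      using that by (auto simp: drift_def post_value_def intro: mult_nonneg_nonpos)
  qed
  then show ?thesis
    using max_rate_pos by (intro that[of 0 0 0 0 0 0 0]) (auto simp: drift_def)
next
  case False
  \<comment> \<open>In the scaled units the margin at rate \<open>x\<close> is
    \<open>\<beta> - x\<close>, so \<open>\<beta>\<close> is the rate at which the price equals the
    cost.\<close>
  define \<beta> where "\<beta> = (b - a * c) / \<mu>"
  have "0 < \<beta>"
    using False service_rate_pos by (simp add: \<beta>_def)
  then obtain s z where sz: "0 < s" "0 < z" "z \<le> \<beta>" "s\<^sup>2 / 2 + 2 * s = z\<^sup>2 + 2 * z" "\<beta> = s\<^sup>2 / 2 + 2 * z"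
    by (rule balanced_rates_exist)
  define q where "q = \<mu>\<^sup>2 / a"
  have q: "0 < q"
    using slope_pos service_rate_pos by (simp add: q_def)
  have binomials: "(0 choose 2) = 0" "(Suc 0 choose 2) = 0" "(2 choose 2) = 1" "(Suc (Suc 0) choose 2) = 1"
    by (simp_all add: numeral_2_eq_2)
  \<comment> \<open>The coefficients make the two increments of \<open>post_value\<close> equal to
    \<open>- u1\<close> and \<open>- u2\<close> in units of \<open>\<mu> / a\<close>.\<close>
  have drifts:
    "drift (- u1 * \<mu> / a) ((u1 - u2) * \<mu> / a) 0 (\<mu> * x) = q * (x * (\<beta> - u1 - x))"
    "drift (- u1 * \<mu> / a) ((u1 - u2) * \<mu> / a) 1 (\<mu> * x) = q * (x * (\<beta> - u2 - x) + u1)"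
    "drift (- u1 * \<mu> / a) ((u1 - u2) * \<mu> / a) 2 (\<mu> * x) = q * (2 * u2)" for u1 u2 x
  proof -
    have margin: "price (\<mu> * x) - c = \<mu> / a * (\<beta> - x)"
      using slope_pos service_rate_pos by (simp add: price_def \<beta>_def field_simps)
    show "drift (- u1 * \<mu> / a) ((u1 - u2) * \<mu> / a) 0 (\<mu> * x) = q * (x * (\<beta> - u1 - x))"
      "drift (- u1 * \<mu> / a) ((u1 - u2) * \<mu> / a) 1 (\<mu> * x) = q * (x * (\<beta> - u2 - x) + u1)"
      "drift (- u1 * \<mu> / a) ((u1 - u2) * \<mu> / a) 2 (\<mu> * x) = q * (2 * u2)"
      unfolding drift_def post_value_def margin using slope_pos assms
      by (simp_all add: binomials q_def power2_eq_square field_simps)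
  qed
  have cases_le_2: "P k" if "k \<le> C" "P 0" "P 1" "P 2" for P and k :: nat
    using that assms by (auto simp: numeral_2_eq_2 le_Suc_eq)
  \<comment> \<open>The profit of the static rate \<open>z\<close> by Erlang's loss formula:
    \<open>s\<^sup>2 / 2 + z\<close> is the margin \<open>\<beta> - z\<close>, and
    \<open>(1 + z) / (1 + z + z\<^sup>2 / 2)\<close> is the stationary probability that a unit is
    free.\<close>
  define g where "g = z * (s\<^sup>2 / 2 + z) * (1 + z) / (1 + z + z\<^sup>2 / 2)"
  \<comment> \<open>Constant drift \<open>g\<close> forces the opportunity cost \<open>u\<close> in
    state 0 and \<open>g / 2\<close> in state 2; the remaining equation in state 1 holds because
    \<open>g\<close> is the stationary profit.\<close>
  define u where "u = (z * (s\<^sup>2 / 2 + z) - g) / z"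
  have den: "0 < 1 + z + z\<^sup>2 / 2"
    using sz by (simp add: add_pos_pos)
  have u: "z * (\<beta> - u - z) = g" "z * (\<beta> - g / 2 - z) + u = g"
  proof -
    have zu: "z * u = z * (s\<^sup>2 / 2 + z) - g"
      using sz by (simp add: u_def)
    then show "z * (\<beta> - u - z) = g"
      using sz(5) by (simp add: algebra_simps)
    have g: "z * (s\<^sup>2 / 2 + z) * (1 + z) = g * (1 + z + z\<^sup>2 / 2)"
      using den by (simp add: g_def)
    have "z * (z * (\<beta> - g / 2 - z) + u) = z * (z * (\<beta> - g / 2 - z)) + z * u"
      by (simp add: distrib_left)
    also have "\<dots> = z * (s\<^sup>2 / 2 + z) * (1 + z) - g * (1 + z\<^sup>2 / 2)"
      unfolding zu sz(5) by (simp add: power2_eq_square field_simps)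
    also have "\<dots> = z * g"
      unfolding g by (simp add: algebra_simps)
    finally have "z * (z * (\<beta> - g / 2 - z) + u) = z * g" .
    then show "z * (\<beta> - g / 2 - z) + u = g"
      using sz by simp
  qed
  \<comment> \<open>For the bound \<open>s\<^sup>2\<close>, equality in states 0 and 2 is achieved
    by \<open>u1 = \<beta> - 2 * s\<close> and \<open>u2 = s\<^sup>2 / 2\<close>. In state 1 the
    best gain is \<open>z\<^sup>2\<close>, and this identity says that adding \<open>u1\<close>
    gives \<open>s\<^sup>2\<close> again.\<close>
  have s2: "\<beta> - 2 * s = s\<^sup>2 - z\<^sup>2"
    using sz(4,5) by simp
  show ?thesis
  proof
    have "\<mu> * z \<le> b - a * c"
      using sz(3) service_rate_pos by (simp add: \<beta>_def field_simps)
    also have "\<dots> \<le> b"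
      using slope_pos cost_pos by simp
    finally show "\<mu> * z \<in> {0..b}"
      using sz service_rate_pos by simp
    show "0 \<le> q * g"
      using q sz den by (simp add: g_def)
    show "0.955 * (q * s\<^sup>2) \<le> q * g"
      using mult_left_mono[OF static_rate_ratio[OF sz(1,2,4)] less_imp_le[OF q]]
      unfolding g_def by (simp only: mult.left_commute)
    show "drift (- u * \<mu> / a) ((u - g / 2) * \<mu> / a) k (\<mu> * z) = q * g" if "k \<le> C" for k
      using that
    proof (rule cases_le_2)
      show "drift (- u * \<mu> / a) ((u - g / 2) * \<mu> / a) 0 (\<mu> * z) = q * g"
        unfolding drifts u ..
      show "drift (- u * \<mu> / a) ((u - g / 2) * \<mu> / a) 1 (\<mu> * z) = q * g"
        unfolding drifts u ..
      show "drift (- u * \<mu> / a) ((u - g / 2) * \<mu> / a) 2 (\<mu> * z) = q * g"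
        unfolding drifts by simp
    qed
    show "drift (- (\<beta> - 2 * s) * \<mu> / a) ((\<beta> - 2 * s - s\<^sup>2 / 2) * \<mu> / a) k l \<le> q * s\<^sup>2"
      if "k \<le> C" for k l
    proof -
      have "l = \<mu> * (l / \<mu>)"
        using service_rate_pos by simp
      have "drift (- (\<beta> - 2 * s) * \<mu> / a) ((\<beta> - 2 * s - s\<^sup>2 / 2) * \<mu> / a) k (\<mu> * x) \<le> q * s\<^sup>2" for x
        using \<open>k \<le> C\<close>
      proof (rule cases_le_2)
        have "x * (\<beta> - (\<beta> - 2 * s) - x) \<le> s\<^sup>2"
          using quadratic_gain_le[of x s] by simp
        then show "drift (- (\<beta> - 2 * s) * \<mu> / a) ((\<beta> - 2 * s - s\<^sup>2 / 2) * \<mu> / a) 0 (\<mu> * x) \<le> q * s\<^sup>2"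
          using q unfolding drifts by simp
        have "x * (\<beta> - s\<^sup>2 / 2 - x) + (\<beta> - 2 * s) \<le> s\<^sup>2"
          using quadratic_gain_le[of x z] unfolding s2 by (simp add: sz(5))
        then show "drift (- (\<beta> - 2 * s) * \<mu> / a) ((\<beta> - 2 * s - s\<^sup>2 / 2) * \<mu> / a) 1 (\<mu> * x) \<le> q * s\<^sup>2"
          using q unfolding drifts by simp
        show "drift (- (\<beta> - 2 * s) * \<mu> / a) ((\<beta> - 2 * s - s\<^sup>2 / 2) * \<mu> / a) 2 (\<mu> * x) \<le> q * s\<^sup>2"
          unfolding drifts by simp
      qed
      from this[of "l / \<mu>"] \<open>l = \<mu> * (l / \<mu>)\<close> show ?thesis
        by simp
    qed
  qed
qed

end

theorem theorem2:
  fixes M :: "'w measure" and a b \<mu> c :: real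
    and gap val service :: "nat \<Rightarrow> 'w \<Rightarrow> real" and exo :: "'w \<Rightarrow> real"
    and \<pi> :: "real \<Rightarrow> 'w \<Rightarrow> real"
  assumes "reusable_resource M 2 a b \<mu> c gap val service exo"
    and "reusable_resource.optimal_policy M 2 a b c gap val service exo \<pi>"
  shows "\<exists>\<sigma>. reusable_resource.static_policy M b gap val service exo \<sigma> \<and>
           ereal 0.955 * reusable_resource.profit_rate M 2 a b c gap val service \<pi>
             \<le> reusable_resource.profit_rate M 2 a b c gap val service \<sigma> \<and>
           (reusable_resource.profit_rate M 2 a b c gap val service \<pi> \<noteq> 0 \<longrightarrow>
            ereal 0.955
              \<le> reusable_resource.profit_rate M 2 a b c gap val service \<sigma>
                / reusable_resource.profit_rate M 2 a b c gap val service \<pi>)"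
proof -
  interpret reusable_resource M 2 a b \<mu> c gap val service exo
    by fact
  obtain l g h A G A' G' where l: "l \<in> {0..b}" and g: "0 \<le> g" "0.955 * h \<le> g"
    and static: "\<And>k. k \<le> 2 \<Longrightarrow> drift A G k l = g"
    and dynamic: "\<And>k l. k \<le> 2 \<Longrightarrow> 0 \<le> l \<Longrightarrow> l \<le> b \<Longrightarrow> drift A' G' k l \<le> h"
    by (rule static_rate_exists[OF refl]) (rule that)
  let ?\<sigma> = "\<lambda>_ _. l"
  have \<sigma>: "policy ?\<sigma>" "ereal g \<le> profit_rate ?\<sigma>"
    using policy_const[OF l] static_profit_rate[OF l static] by auto
  have \<pi>: "policy \<pi>" "profit_rate ?\<sigma> \<le> profit_rate \<pi>"
    using assms(2) \<sigma>(1) by (auto simp: optimal_policy_def)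
  have upper: "profit_rate \<pi> \<le> ereal h"
    by (rule profit_rate_le_drift[OF \<pi>(1) dynamic])
  \<comment> \<open>Both profit rates lie between \<open>g\<close> and \<open>h\<close>, so they are
    real and the extended quotient is an ordinary one.\<close>
  obtain r where r: "profit_rate \<pi> = ereal r"
    using upper \<sigma>(2) \<pi>(2) by (cases "profit_rate \<pi>") auto
  obtain t where t: "profit_rate ?\<sigma> = ereal t"
    using \<sigma>(2) \<pi>(2) r by (cases "profit_rate ?\<sigma>") auto
  have "0 \<le> r" "0.955 * r \<le> t"
    using upper \<sigma>(2) \<pi>(2) g by (auto simp: r t)
  moreover have "static_policy ?\<sigma>"
    using \<sigma>(1) by (auto simp: static_policy_def)
  ultimately show ?thesis
    by (intro exI[of _ ?\<sigma>]) (auto simp: r t zero_ereal_def pos_le_divide_eq)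
qed

end
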